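(* Let $H$ be a group and let $\mathcal{P} = \langle \mathbf{x}, H; R\rangle$ be a one-relator relative presentation whose $\mathbf{x}$-skeleton $W$ has the unique min property. Then $\mathcal{P}$ is (diagrammatically) aspherical.
   Context: A one-relator relative presentation $\mathcal{P} = \langle \mathbf{x}, H; R\rangle$ consists of a set $\mathbf{x}$, a group $H$, and an expression $R = x_1^{\varepsilon_1} h_1 x_2^{\varepsilon_2} h_2 \cdots x_r^{\varepsilon_r} h_r$ with $r>0$, $x_i \in \mathbf{x}$, $\varepsilon_i = \pm 1$, $h_i \in H$. The word $W = x_1^{\varepsilon_1} \cdots x_r^{\varepsilon_r}$ is the $\mathbf{x}$-skeleton of $R$; it is not required to be reduced or cyclically reduced. Unique min property. A weight function on $\mathbf{x}$ is a function $\theta: \mathbf{x} \to \mathbb{Z}$ whose image generates the additive group $\mathbb{Z}$; it is strict if $\theta(x) \neq 0$ for all $x \in \mathbf{x}$. Put $\phi(j) = \sum_{i=1}^{j} \varepsilon_i \theta(x_i)$ for $0\le j\le r$. The weight function is admissible for $W$ if $\phi(r)=0$. $W$ has the unique min property if there are an admissible strict weight function $\theta$ and $l \in \{1,\ldots,r\}$ such that $\phi(j) > \phi(l)$ for all $j \in \{1,\ldots,r\}\setminus\{l\}$ and $x_l \neq x_{l+1}$ (subscripts modulo $r$). Pictures (in the sense of Bogley and Pride). A picture is a finite collection of pairwise disjoint closed discs in the interior of a closed disc $D^2$, together with a finite collection of pairwise disjoint simple arcs properly embedded in the closure of the complement of the discs in $D^2$, each arc being either a simple closed curve missing $\partial D^2$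 and all the discs, or a simple arc joining two points that lie on $\partial D^2$ or on boundaries of discs. The corners of a disc $\Delta$ are the closures of the components of $\partial \Delta$ minus the arcs. The regions are the components of the complement in $D^2$ of the discs and arcs; a region is inner if its closure does not meet $\partial D^2$. The picture is connected if the union of its discs and arcs is connected, and spherical if it has at least one disc and no arc meets $\partial D^2$. A picture over $\mathcal{P}$ is a picture in which each arc has a transverse (normal) orientation and a label in $\mathbf{x} \cup \mathbf{x}^{-1}$, and each corner (oriented clockwise) has a label in $H$, as follows. Crossing an arc labelled $y$ in the direction of its normal orientation reads $y$, and crossing it in the opposite direction reads $y^{-1}$. For a corner $\kappa$ of a disc $\Delta$, let $W(\kappa)$ be the word obtained by reading clockwise around $\partial\Delta$ the labels of the arcs and corners met, beginning with the first arc met after $\kappa$ (and so ending with the label of $\kappa$). It is required that: (1) for each corner $\kappa$, $W(\kappa)$ is, as a word in letters from $\mathbf{x}^{\pm1}$ and $H$, a cyclic permutation of $R$ or of $R^{-1}$ that begins with a letter of $\mathbf{x}^{\pm1}$ (here the cyclic permutations of $R^{-1}$ are those of $x_r^{-\varepsilon_r} h_{r-1}^{-1} x_{r-1}^{-\varepsilon_{r-1}} \cdots h_1^{-1} x_1^{-\varepsilon_1} h_r^{-1}$); (2) for each inner region, the product of the corner labels met in an anticlockwise traversal of the boundary of the region is $1$ in $H$. A dipole in a picture over $\mathcal{P}$ consists of corners $\kappa, \kappa'$ of the picture together with an arc joining them (one end of the arc is an endpoint of $\kappa$, the other is an endpoint of $\kappa'$), such that $\kappa$ and $\kappa'$ lie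 in the same region, and if $W(\kappa) = S h$ with $h \in H$ and $S$ beginning and ending with letters of $\mathbf{x}^{\pm 1}$, then $W(\kappa') = S^{-1} h^{-1}$. $\mathcal{P}$ is (diagrammatically) aspherical if every connected spherical picture over $\mathcal{P}$ contains a dipole. *)

theory Defs
  imports "HOL-Complex_Analysis.Winding_Numbers" "HOL-Algebra.Elementary_Groups"
begin

text \<open>
  The relator \<open>x\<^sub>1\<^bsup>\<epsilon>\<^sub>1\<^esup> h\<^sub>1 \<dots> x\<^sub>r\<^bsup>\<epsilon>\<^sub>r\<^esup> h\<^sub>r\<close> is the list of the triples \<open>(x\<^sub>i, \<epsilon>\<^sub>i, h\<^sub>i)\<close>.
\<close>

type_synonym ('x, 'h) relator = "('x \<times> int \<times> 'h) list"

definition relative_presentation ::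
    "'x set \<Rightarrow> ('h, 'm) monoid_scheme \<Rightarrow> ('x, 'h) relator \<Rightarrow> bool" where
  "relative_presentation X H R \<longleftrightarrow>
     group H \<and> R \<noteq> [] \<and>
     (\<forall>(x, e, h) \<in> set R. x \<in> X \<and> e \<in> {1, -1} \<and> h \<in> carrier H)"

definition skeleton :: "('x, 'h) relator \<Rightarrow> ('x \<times> int) list" where
  "skeleton R = map (\<lambda>(x, e, h). (x, e)) R"

datatype ('x, 'h) letter = Gen 'x int | Coef 'h

definition relator_word :: "('x, 'h) relator \<Rightarrow> ('x, 'h) letter list" where
  "relator_word R = concat (map (\<lambda>(x, e, h). [Gen x e, Coef h]) R)"

fun letter_inv :: "('h, 'm) monoid_scheme \<Rightarrow> ('x, 'h) letter \<Rightarrow> ('x, 'h) letter" where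
  "letter_inv H (Gen x e) = Gen x (- e)"
| "letter_inv H (Coef h) = Coef (inv\<^bsub>H\<^esub> h)"

definition word_inv ::
    "('h, 'm) monoid_scheme \<Rightarrow> ('x, 'h) letter list \<Rightarrow> ('x, 'h) letter list" where
  "word_inv H w = rev (map (letter_inv H) w)"

definition is_gen :: "('x, 'h) letter \<Rightarrow> bool" where
  "is_gen a \<longleftrightarrow> (\<exists>x e. a = Gen x e)"

definition relator_cycles ::
    "('h, 'm) monoid_scheme \<Rightarrow> ('x, 'h) relator \<Rightarrow> ('x, 'h) letter list set" where
  "relator_cycles H R =
     {w. (\<exists>n. w = rotate n (relator_word R) \<or> w = rotate n (word_inv H (relator_word R))) \<and>
         w \<noteq> [] \<and> is_gen (hd w)}"

definition weight_function :: "'x set \<Rightarrow> ('x \<Rightarrow> int) \<Rightarrow> bool" where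
  "weight_function X \<theta> \<longleftrightarrow> generate integer_group (\<theta> ` X) = carrier integer_group"

definition strict_weight :: "'x set \<Rightarrow> ('x \<Rightarrow> int) \<Rightarrow> bool" where
  "strict_weight X \<theta> \<longleftrightarrow> (\<forall>x \<in> X. \<theta> x \<noteq> 0)"

definition prefix_weight :: "('x \<Rightarrow> int) \<Rightarrow> ('x \<times> int) list \<Rightarrow> nat \<Rightarrow> int" where
  "prefix_weight \<theta> W j = (\<Sum>i = 1..j. snd (W ! (i - 1)) * \<theta> (fst (W ! (i - 1))))"

definition admissible :: "('x \<Rightarrow> int) \<Rightarrow> ('x \<times> int) list \<Rightarrow> bool" where
  "admissible \<theta> W \<longleftrightarrow> prefix_weight \<theta> W (length W) = 0"

text \<open>
  As lists are indexed from 0, \<open>x\<^sub>l\<close> and \<open>x\<^sub>l\<^sub>+\<^sub>1\<close> (subscripts modulo \<open>r\<close>) are found at the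
  positions \<open>l - 1\<close> and \<open>l mod r\<close>.
\<close>

definition unique_min :: "'x set \<Rightarrow> ('x \<times> int) list \<Rightarrow> bool" where
  "unique_min X W \<longleftrightarrow>
     (\<exists>\<theta> l. weight_function X \<theta> \<and> strict_weight X \<theta> \<and> admissible \<theta> W \<and>
        l \<in> {1..length W} \<and>
        (\<forall>j \<in> {1..length W} - {l}. prefix_weight \<theta> W j > prefix_weight \<theta> W l) \<and>
        fst (W ! (l - 1)) \<noteq> fst (W ! (l mod length W)))"

text \<open>
  The ambient disc \<open>D\<^sup>2\<close> is the closed unit disc of the complex plane; the discs of a picture
  are arbitrary closed topological discs, and its arcs are arbitrary topological arcs.
\<close>

record picture =
  discs :: "complex set set"
  arcs :: "complex set set"

abbreviation disc_union :: "'a picture_scheme \<Rightarrow> complex set" where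
  "disc_union P \<equiv> \<Union> (discs P)"

abbreviation arc_union :: "'a picture_scheme \<Rightarrow> complex set" where
  "arc_union P \<equiv> \<Union> (arcs P)"

definition closed_curve_param :: "'a picture_scheme \<Rightarrow> (real \<Rightarrow> complex) \<Rightarrow> bool" where
  "closed_curve_param P \<gamma> \<longleftrightarrow>
     simple_path \<gamma> \<and> pathfinish \<gamma> = pathstart \<gamma> \<and>
     path_image \<gamma> \<subseteq> ball 0 1 - disc_union P"

definition proper_arc_param :: "'a picture_scheme \<Rightarrow> (real \<Rightarrow> complex) \<Rightarrow> bool" where
  "proper_arc_param P \<gamma> \<longleftrightarrow>
     arc \<gamma> \<and> path_image \<gamma> \<subseteq> closure (cball 0 1 - disc_union P) \<and>
     path_image \<gamma> \<inter> (sphere 0 1 \<union> \<Union> (frontier ` discs P)) = {pathstart \<gamma>, pathfinish \<gamma>}"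

definition is_picture :: "'a picture_scheme \<Rightarrow> bool" where
  "is_picture P \<longleftrightarrow>
     finite (discs P) \<and> pairwise disjnt (discs P) \<and>
     (\<forall>\<Delta> \<in> discs P. \<Delta> homeomorphic (cball 0 1 :: complex set) \<and> \<Delta> \<subseteq> ball 0 1) \<and>
     finite (arcs P) \<and> pairwise disjnt (arcs P) \<and>
     (\<forall>A \<in> arcs P. \<exists>\<gamma>. path_image \<gamma> = A \<and> (closed_curve_param P \<gamma> \<or> proper_arc_param P \<gamma>))"

definition corners :: "'a picture_scheme \<Rightarrow> complex set set" where
  "corners P = (\<Union>\<Delta> \<in> discs P. closure ` components (frontier \<Delta> - arc_union P))"

definition regions :: "'a picture_scheme \<Rightarrow> complex set set" where
  "regions P = components (cball 0 1 - (disc_union P \<union> arc_union P))"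

definition inner_region :: "'a picture_scheme \<Rightarrow> complex set \<Rightarrow> bool" where
  "inner_region P F \<longleftrightarrow> F \<in> regions P \<and> closure F \<inter> sphere 0 1 = {}"

definition connected_picture :: "'a picture_scheme \<Rightarrow> bool" where
  "connected_picture P \<longleftrightarrow> connected (disc_union P \<union> arc_union P)"

definition spherical :: "'a picture_scheme \<Rightarrow> bool" where
  "spherical P \<longleftrightarrow> discs P \<noteq> {} \<and> (\<forall>A \<in> arcs P. A \<inter> sphere 0 1 = {})"

definition clockwise_boundary :: "complex set \<Rightarrow> (real \<Rightarrow> complex) \<Rightarrow> bool" where
  "clockwise_boundary \<Delta> c \<longleftrightarrow>
     simple_path c \<and> pathfinish c = pathstart c \<and> path_image c = frontier \<Delta> \<and>
     (\<forall>z \<in> interior \<Delta>. winding_number c z = -1)"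

text \<open>
  \<open>corner_span P \<kappa> p q\<close>: the corner \<open>\<kappa>\<close>, traversed clockwise around its disc, runs from \<open>p\<close> to
  \<open>q\<close>. If only one end of an arc lies on the disc, then \<open>p = q\<close> and \<open>\<kappa>\<close> is the whole boundary.
\<close>

definition corner_span :: "'a picture_scheme \<Rightarrow> complex set \<Rightarrow> complex \<Rightarrow> complex \<Rightarrow> bool" where
  "corner_span P \<kappa> p q \<longleftrightarrow>
     (\<exists>\<Delta> \<in> discs P. \<exists>c s t. clockwise_boundary \<Delta> c \<and> 0 \<le> s \<and> s < t \<and> t \<le> 1 \<and>
        c s = p \<and> c t = q \<and> \<kappa> = c ` {s..t} \<and>
        p \<in> arc_union P \<and> q \<in> arc_union P \<and> c ` {s<..<t} \<inter> arc_union P = {})"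

definition corner_endpoint :: "'a picture_scheme \<Rightarrow> complex set \<Rightarrow> complex \<Rightarrow> bool" where
  "corner_endpoint P \<kappa> p \<longleftrightarrow> (\<exists>q. corner_span P \<kappa> p q \<or> corner_span P \<kappa> q p)"

definition joins :: "complex set \<Rightarrow> complex \<Rightarrow> complex \<Rightarrow> bool" where
  "joins A p q \<longleftrightarrow> (\<exists>\<gamma>. arc \<gamma> \<and> path_image \<gamma> = A \<and> pathstart \<gamma> = p \<and> pathfinish \<gamma> = q)"

text \<open>
  A region that lies to the left of its boundary traversal (as in an anticlockwise traversal) has
  the discs on the right, so each corner is passed clockwise with respect to its disc. At the end
  of a corner the traversal follows the arc met there to its other end, where the next corner
  starts. The cycle below lists the corners in the order met, from an arbitrary starting point.
\<close>

definition next_corner :: "'a picture_scheme \<Rightarrow> complex set \<Rightarrow> complex set \<Rightarrow> bool" where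
  "next_corner P \<kappa> \<kappa>' \<longleftrightarrow>
     (\<exists>A \<in> arcs P. \<exists>p q p' q'. corner_span P \<kappa> p q \<and> joins A q p' \<and> corner_span P \<kappa>' p' q')"

definition boundary_cycle :: "'a picture_scheme \<Rightarrow> complex set \<Rightarrow> complex set list \<Rightarrow> bool" where
  "boundary_cycle P F ks \<longleftrightarrow>
     ks \<noteq> [] \<and> distinct ks \<and> set ks \<subseteq> {\<kappa> \<in> corners P. \<kappa> \<subseteq> closure F} \<and>
     (\<forall>i < length ks. next_corner P (ks ! i) (ks ! (Suc i mod length ks)))"

text \<open>
  A transverse orientation of an arc is recorded by a direction of travel along the arc, given
  by the parametrization \<open>along\<close>: the normal orientation points to the right-hand side of the
  traveller. Going clockwise around a disc one crosses an arc that leaves the disc from its left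
  to its right, and an arc that arrives at the disc from its right to its left.
\<close>

record ('x, 'h) labelled_picture = picture +
  along :: "complex set \<Rightarrow> real \<Rightarrow> complex"
  arc_label :: "complex set \<Rightarrow> 'x \<times> int"
  corner_label :: "complex set \<Rightarrow> 'h"

definition crossing_letter :: "('x, 'h, 'a) labelled_picture_scheme \<Rightarrow> complex \<Rightarrow> ('x, 'h) letter" where
  "crossing_letter P p =
     (let A = (THE A. A \<in> arcs P \<and> p \<in> A); (x, e) = arc_label P A
      in if p = pathstart (along P A) then Gen x e else Gen x (- e))"

text \<open>
  \<open>corner_word P \<kappa> w\<close>: \<open>w\<close> is the word \<open>W(\<kappa>)\<close>. The loop \<open>c\<close> starts at the clockwise end of \<open>\<kappa>\<close>;
  \<open>ts\<close> lists the times at which it meets the arcs, and \<open>\<kappa>\<close> is traversed last.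
\<close>

definition corner_word ::
    "('x, 'h, 'a) labelled_picture_scheme \<Rightarrow> complex set \<Rightarrow> ('x, 'h) letter list \<Rightarrow> bool" where
  "corner_word P \<kappa> w \<longleftrightarrow>
     (\<exists>\<Delta> \<in> discs P. \<exists>c ts. clockwise_boundary \<Delta> c \<and>
        ts \<noteq> [] \<and> sorted_wrt (<) ts \<and> set ts = {t \<in> {0..<1}. c t \<in> arc_union P} \<and>
        hd ts = 0 \<and> \<kappa> = c ` {last ts..1} \<and>
        w = concat (map2 (\<lambda>s t. [crossing_letter P (c s), Coef (corner_label P (c ` {s..t}))])
                         ts (tl ts @ [1])))"

definition picture_over ::
    "'x set \<Rightarrow> ('h, 'm) monoid_scheme \<Rightarrow> ('x, 'h) relator \<Rightarrow>
     ('x, 'h, 'a) labelled_picture_scheme \<Rightarrow> bool" where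
  "picture_over X H R P \<longleftrightarrow>
     is_picture P \<and>
     (\<forall>A \<in> arcs P. path_image (along P A) = A \<and>
        (closed_curve_param P (along P A) \<or> proper_arc_param P (along P A))) \<and>
     (\<forall>A \<in> arcs P. arc_label P A \<in> X \<times> {1, -1}) \<and>
     (\<forall>\<kappa> \<in> corners P. corner_label P \<kappa> \<in> carrier H) \<and>
     (\<forall>\<kappa> \<in> corners P. \<exists>w \<in> relator_cycles H R. corner_word P \<kappa> w) \<and>
     (\<forall>F ks. inner_region P F \<longrightarrow> boundary_cycle P F ks \<longrightarrow>
        foldr (\<otimes>\<^bsub>H\<^esub>) (map (corner_label P) ks) \<one>\<^bsub>H\<^esub> = \<one>\<^bsub>H\<^esub>)"

definition has_dipole ::
    "('h, 'm) monoid_scheme \<Rightarrow> ('x, 'h, 'a) labelled_picture_scheme \<Rightarrow> bool" where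
  "has_dipole H P \<longleftrightarrow>
     (\<exists>\<kappa> \<in> corners P. \<exists>\<kappa>' \<in> corners P. \<exists>A \<in> arcs P.
        (\<exists>p q. joins A p q \<and> corner_endpoint P \<kappa> p \<and> corner_endpoint P \<kappa>' q) \<and>
        (\<exists>F \<in> regions P. \<kappa> \<subseteq> closure F \<and> \<kappa>' \<subseteq> closure F) \<and>
        (\<exists>S h. S \<noteq> [] \<and> is_gen (hd S) \<and> is_gen (last S) \<and>
           corner_word P \<kappa> (S @ [Coef h]) \<and>
           corner_word P \<kappa>' (word_inv H S @ [Coef (inv\<^bsub>H\<^esub> h)])))"

definition aspherical ::
    "'x set \<Rightarrow> ('h, 'm) monoid_scheme \<Rightarrow> ('x, 'h) relator \<Rightarrow> bool" where
  "aspherical X H R \<longleftrightarrow>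
     (\<forall>P :: ('x, 'h) labelled_picture.
        picture_over X H R P \<and> connected_picture P \<and> spherical P \<longrightarrow> has_dipole H P)"

end

theory Submission
  imports Defs
begin

text \<open>
  Crossing an arc labelled \<open>x\<close> along its orientation changes a potential by \<open>\<theta> x\<close>; since \<open>\<theta>\<close> is
  admissible and the picture lies in the plane, the potential is a well-defined function on regions
  and corners. Take a corner where it is minimal. Around its disc the potential follows the prefix
  sums of \<open>W\<close> (or of \<open>W\<^sup>-\<^sup>1\<close>), so by the unique min property the corner is the one at the position
  \<open>l\<close>. Follow the region that meets the
  disc in this corner along the arc at the end of the corner: it leads to a second corner, where the
  potential is minimal as well. Strictness makes this arc the last letter at the second corner, and
  \<open>x\<^sub>l \<noteq> x\<^sub>l\<^sub>+\<^sub>1\<close> forces the second disc to be read in the opposite direction, which gives a dipole.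

  The potential is the total winding number of a 1-cycle: the arcs, weighted by \<open>\<theta>\<close> and prolonged
  inside the discs to their centres. That the region follows an arc to its other end comes from
  Janiszewski's theorem, applied after cutting the arc or cutting off a cap of the disc. It is not
  necessary to keep track of the two sides of the arc there: the potential tells them apart.
\<close>

section \<open>Topological discs in the plane\<close>

text \<open>Discs and arcs are merely topological, so an arc comes without a collar in which it
  could be crossed in a controlled way. Hence no arc is ever crossed: the change of the potential is
  measured inside the discs, where the prolongation of an arc is a ray of a cone and can be passed
  along the image of a circle. A frontier point off the arcs is also off the cycle, so its potential
  links the inside of the disc with the adjacent region. Winding numbers suit this setting because
  they need no transversality: off the cycle their weighted sum is continuous and integral, hence
  constant on connected sets. Janiszewski's theorem says that two closed sets with connected
  intersection, one of them compact, do not separate two points together if neither does so alone.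
  In the indirect arguments a piece of the barrier that the component does not touch is deleted;
  what is left splits into two such sets, and the component would contain a point of the
  barrier.\<close>

lemma homeomorphic_cball_frontier:
  fixes \<Delta> :: "complex set"
  assumes "\<Delta> homeomorphic (cball 0 1 :: complex set)"
  obtains f g :: "complex \<Rightarrow> complex" where "homeomorphism (cball 0 1) \<Delta> f g"
    "f ` ball 0 1 = interior \<Delta>" "f ` sphere 0 1 = frontier \<Delta>"
proof -
  obtain f g where h: "homeomorphism (cball 0 1) \<Delta> f (g :: complex \<Rightarrow> complex)"
    using assms homeomorphic_sym unfolding homeomorphic_def by blast
  have cf: "continuous_on (cball 0 1) f" and cg: "continuous_on \<Delta> g"
    and fi: "f ` cball 0 1 = \<Delta>" and gi: "g ` \<Delta> = cball 0 1"
    and gf: "\<And>x. x \<in> cball 0 1 \<Longrightarrow> g (f x) = x" and fg: "\<And>y. y \<in> \<Delta> \<Longrightarrow> f (g y) = y"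
    using h by (auto simp: homeomorphism_def)
  have injf: "inj_on f (cball 0 1)" and injg: "inj_on g \<Delta>"
    using inj_on_inverseI[of _ g f] inj_on_inverseI[of _ f g] gf fg by blast+
  have bc: "ball (0::complex) 1 \<subseteq> cball 0 1" by auto
  have "open (f ` ball 0 1)"
    using cf injf bc by (intro invariance_of_domain) (auto intro: continuous_on_subset inj_on_subset)
  hence 1: "f ` ball 0 1 \<subseteq> interior \<Delta>"
    using fi bc by (intro interior_maximal) auto
  have "open (g ` interior \<Delta>)"
    using cg injg interior_subset[of \<Delta>]
    by (intro invariance_of_domain) (auto intro: continuous_on_subset inj_on_subset)
  moreover have "g ` interior \<Delta> \<subseteq> cball 0 1" using gi interior_subset by blast
  ultimately have "g ` interior \<Delta> \<subseteq> interior (cball 0 1)" by (rule interior_maximal[rotated])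
  hence 2: "g ` interior \<Delta> \<subseteq> ball 0 1" by (metis interior_cball)
  have 2: "interior \<Delta> \<subseteq> f ` ball 0 1"
  proof
    fix y assume "y \<in> interior \<Delta>"
    with 2 have "g y \<in> ball 0 1" "f (g y) = y" using fg interior_subset[of \<Delta>] by auto
    thus "y \<in> f ` ball 0 1" by (metis imageI)
  qed
  have 3: "f ` ball 0 1 = interior \<Delta>" using 1 2 by blast
  have "compact \<Delta>" using compact_continuous_image[OF cf] fi by simp
  hence "frontier \<Delta> = \<Delta> - interior \<Delta>" by (simp add: frontier_def compact_imp_closed)
  also have "\<dots> = f ` (cball 0 1 - ball 0 1)"
    using 3 fi injf bc inj_on_image_set_diff[of f "cball 0 1" "cball 0 1" "ball 0 1"] by auto
  also have "cball 0 1 - ball 0 1 = sphere (0::complex) 1" by auto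
  finally have "f ` sphere 0 1 = frontier \<Delta>" by (rule sym)
  thus thesis using that[OF h 3] by simp
qed

lemma homeomorphic_cball_compact:
  assumes "\<Delta> homeomorphic (cball 0 1 :: complex set)"
  shows "compact \<Delta>"
  using homeomorphic_compactness[OF assms] by simp

lemma connected_complement_disc:
  fixes \<Delta> :: "complex set"
  assumes "\<Delta> homeomorphic (cball 0 1 :: complex set)"
  shows "connected (- \<Delta>)"
  using connected_complement_homeomorphic_convex_compact[OF assms] by simp

text \<open>Only finitely many frontier points are ends of arcs, so this provides frontier points
  off the arcs.\<close>

lemma infinite_frontier_disc:
  fixes \<Delta> :: "complex set"
  assumes "\<Delta> homeomorphic (cball 0 1 :: complex set)"
  shows "infinite (frontier \<Delta>)"
proof -
  obtain f g :: "complex \<Rightarrow> complex" where h: "homeomorphism (cball 0 1) \<Delta> f g" and s: "f ` sphere 0 1 = frontier \<Delta>"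
    using homeomorphic_cball_frontier[OF assms] by metis
  have "inj_on f (sphere 0 1)"
    using h by (auto simp: homeomorphism_def intro!: inj_on_inverseI[of _ g])
  moreover have "infinite (sphere (0::complex) 1)"
  proof
    assume "finite (sphere (0::complex) 1)"
    hence "sphere (0::complex) 1 = {} \<or> (\<exists>a. sphere (0::complex) 1 = {a})"
      using connected_finite_iff_sing[of "sphere (0::complex) 1"] by (simp add: connected_sphere)
    moreover have "1 \<in> sphere (0::complex) 1" "-1 \<in> sphere (0::complex) 1" by auto
    ultimately have "(1::complex) = -1" by (metis empty_iff singletonD)
    thus False by simp
  qed
  ultimately show ?thesis by (simp add: finite_image_iff flip: s)
qed

text \<open>The cone structure that the radii of the round disc induce on \<Delta>, with apex
  \<open>m\<close>. It is expressed through frontier points alone, so that the homeomorphism need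
  not be carried along. By the last clause distinct rays meet only in the apex.\<close>

definition disc_rays ::
    "complex set \<Rightarrow> complex \<Rightarrow> (complex \<Rightarrow> real \<Rightarrow> complex) \<Rightarrow> bool" where
  "disc_rays \<Delta> m ray \<longleftrightarrow>
     continuous_on (frontier \<Delta> \<times> {0..1}) (\<lambda>(x, t). ray x t) \<and>
     (\<forall>x \<in> frontier \<Delta>. ray x 0 = m \<and> ray x 1 = x \<and> (\<forall>t. 0 \<le> t \<and> t < 1 \<longrightarrow> ray x t \<in> interior \<Delta>)) \<and>
     (\<forall>x \<in> frontier \<Delta>. \<forall>y \<in> frontier \<Delta>. \<forall>s t. 0 < s \<and> s \<le> 1 \<and> 0 \<le> t \<and> t \<le> 1 \<and>
        ray x s = ray y t \<longrightarrow> x = y)"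

lemma exists_disc_rays:
  assumes "\<Delta> homeomorphic (cball 0 1 :: complex set)"
  obtains m ray where "disc_rays \<Delta> m ray"
proof -
  obtain f g where h: "homeomorphism (cball 0 1) \<Delta> f (g :: complex \<Rightarrow> complex)"
    and b: "f ` ball 0 1 = interior \<Delta>" and s: "f ` sphere 0 1 = frontier \<Delta>"
    using homeomorphic_cball_frontier[OF assms] by metis
  have cf: "continuous_on (cball 0 1) f" and cg: "continuous_on \<Delta> g"
    and gf: "\<And>x. x \<in> cball 0 1 \<Longrightarrow> g (f x) = x" and fg: "\<And>y. y \<in> \<Delta> \<Longrightarrow> f (g y) = y"
    using h by (auto simp: homeomorphism_def)
  have ng: "norm (g x) = 1" if "x \<in> frontier \<Delta>" for x
  proof -
    have "x \<in> f ` sphere 0 1" using that s by simp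
    then obtain u where "u \<in> sphere 0 1" "x = f u" by blast
    thus ?thesis using gf[of u] by simp
  qed
  have fr: "frontier \<Delta> \<subseteq> \<Delta>"
    using homeomorphic_cball_compact[OF assms] compact_imp_closed frontier_subset_eq by blast
  define ray where "ray x t = f (t *\<^sub>R g x)" for x t
  have "continuous_on (frontier \<Delta> \<times> {0..1::real}) (\<lambda>p. f (snd p *\<^sub>R g (fst p)))"
  proof (rule continuous_on_compose2[OF cf])
    show "continuous_on (frontier \<Delta> \<times> {0..1}) (\<lambda>p. snd p *\<^sub>R g (fst p))"
      by (intro continuous_intros continuous_on_compose2[OF cg]) (use fr in auto)
    show "(\<lambda>p. snd p *\<^sub>R g (fst p)) ` (frontier \<Delta> \<times> {0..1}) \<subseteq> cball 0 1"
      using ng by (auto simp: )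
  qed
  hence 1: "continuous_on (frontier \<Delta> \<times> {0..1}) (\<lambda>(x, t). ray x t)"
    by (simp add: ray_def case_prod_beta)
  have 2: "ray x t \<in> interior \<Delta>" if "x \<in> frontier \<Delta>" "0 \<le> t" "t < 1" for x t
  proof -
    have "t *\<^sub>R g x \<in> ball 0 1" using that ng by simp
    thus ?thesis unfolding ray_def using b by blast
  qed
  have 3: "x = y" if x: "x \<in> frontier \<Delta>" and y: "y \<in> frontier \<Delta>" and st: "0 < s" "s \<le> 1" "0 \<le> t" "t \<le> 1"
    and eq: "ray x s = ray y t" for x y s t
  proof -
    have "s *\<^sub>R g x \<in> cball 0 1" "t *\<^sub>R g y \<in> cball 0 1" using ng x y st by auto
    hence e: "s *\<^sub>R g x = t *\<^sub>R g y" using eq gf unfolding ray_def by metis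
    hence "norm (s *\<^sub>R g x) = norm (t *\<^sub>R g y)" by simp
    hence "s = t" using ng[OF x] ng[OF y] st by simp
    hence "g x = g y" using e st by auto
    thus "x = y" using fg fr x y by (metis subsetD)
  qed
  have "disc_rays \<Delta> (f 0) ray"
    unfolding disc_rays_def
  proof (intro conjI ballI allI impI)
    fix x assume "x \<in> frontier \<Delta>"
    thus "ray x 0 = f 0" "ray x 1 = x" using fg fr by (auto simp: ray_def)
  qed (use 1 2 3 in blast)+
  thus thesis using that by blast
qed

text \<open>The compact set is the part of the disc on the far side of a chord that cuts off \<open>x\<close>.\<close>
lemma disc_cap:
  fixes \<Delta> :: "complex set"
  assumes hom: "\<Delta> homeomorphic (cball 0 1 :: complex set)" and x: "x \<in> frontier \<Delta>" and "0 < \<epsilon>"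
  obtains K where "compact K" "connected K" "K \<subseteq> \<Delta>" "x \<notin> K" "\<Delta> - K \<subseteq> ball x \<epsilon>"
proof -
  obtain f g where h: "homeomorphism (cball 0 1) \<Delta> f (g :: complex \<Rightarrow> complex)"
    and s: "f ` sphere 0 1 = frontier \<Delta>"
    using homeomorphic_cball_frontier[OF assms(1)] by metis
  have cf: "continuous_on (cball 0 1) f" and fi: "f ` cball 0 1 = \<Delta>"
    and gf: "\<And>x. x \<in> cball 0 1 \<Longrightarrow> g (f x) = x"
    using h by (auto simp: homeomorphism_def)
  obtain u where u: "norm u = 1" "x = f u" using x s by force
  obtain \<delta> where \<delta>: "\<delta> > 0" "\<And>v. v \<in> cball 0 1 \<Longrightarrow> dist v u < \<delta> \<Longrightarrow> dist (f v) (f u) < \<epsilon>"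
    using cf[unfolded continuous_on_iff, rule_format, of u \<epsilon>] \<open>0 < \<epsilon>\<close> u by (auto simp: Ball_def)
  \<comment> \<open>From |v - u|^2 <= 2 - 2 (u . v): a point with u . v > 1 - \<eta> is closer to
    \<open>u\<close> than sqrt (2 \<eta>) = \<delta>.\<close>
  define \<eta> where "\<eta> = \<delta>\<^sup>2 / 2"
  have "\<eta> > 0" using \<delta> by (simp add: \<eta>_def)
  define C where "C = cball 0 1 \<inter> {v :: complex. u \<bullet> v \<le> 1 - \<eta>}"
  have "convex C" "compact C"
    unfolding C_def by (auto intro!: convex_Int compact_Int_closed simp: convex_halfspace_le closed_halfspace_le)
  have CC: "C \<subseteq> cball 0 1" by (auto simp: C_def)
  have cfC: "continuous_on C f" using cf CC continuous_on_subset by blast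
  show thesis
  proof
    show "compact (f ` C)" using cfC \<open>compact C\<close> by (rule compact_continuous_image)
    show "connected (f ` C)" using cfC \<open>convex C\<close> convex_connected connected_continuous_image by blast
    show "f ` C \<subseteq> \<Delta>" using CC fi by blast
    have "u \<notin> C" using u \<open>\<eta> > 0\<close> by (simp add: C_def flip: power2_norm_eq_inner)
    thus "x \<notin> f ` C" using u gf CC by (metis imageE mem_cball_0 order_refl subsetD)
    show "\<Delta> - f ` C \<subseteq> ball x \<epsilon>"
    proof
      fix y assume y: "y \<in> \<Delta> - f ` C"
      then obtain v where v: "v \<in> cball 0 1" "y = f v" using fi by blast
      with y have "u \<bullet> v > 1 - \<eta>" by (auto simp: C_def)
      moreover have "(dist v u)\<^sup>2 = (norm v)\<^sup>2 - 2 * (u \<bullet> v) + (norm u)\<^sup>2"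
        by (simp add: dist_norm power2_norm_eq_inner inner_diff inner_commute)
      moreover have "(norm v)\<^sup>2 \<le> 1" using v by (simp add: power_le_one)
      ultimately have "(dist v u)\<^sup>2 < \<delta>\<^sup>2" using u by (simp add: \<eta>_def)
      hence "dist v u < \<delta>" using \<delta>(1) by (simp add: power2_less_imp_less)
      thus "y \<in> ball x \<epsilon>" using \<delta>(2)[OF v(1)] v u by (simp add: dist_commute)
    qed
  qed
qed

text \<open>Janiszewski's theorem for \<Delta> and the union of the outside of the ball with the set
  \<open>K\<close> of \<open>disc_cap\<close>: since \<open>K\<close> contains all of \<Delta>
  outside the ball, the two meet exactly in the connected set \<open>K\<close>. Neither separates
  \<open>a\<close> from \<open>b\<close>: the complement of \<Delta> is connected, and a small ball
  about \<open>x\<close> misses \<open>K\<close>.\<close>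

lemma disc_complement_locally_connected:
  fixes \<Delta> :: "complex set"
  assumes hom: "\<Delta> homeomorphic (cball 0 1 :: complex set)" and x: "x \<in> frontier \<Delta>" and "0 < \<epsilon>"
  obtains \<delta> where "0 < \<delta>" "\<delta> \<le> \<epsilon>"
    "\<And>a b. a \<in> ball x \<delta> - \<Delta> \<Longrightarrow> b \<in> ball x \<delta> - \<Delta> \<Longrightarrow> connected_component (ball x \<epsilon> - \<Delta>) a b"
proof -
  obtain K where K: "compact K" "connected K" "K \<subseteq> \<Delta>" "x \<notin> K" "\<Delta> - K \<subseteq> ball x \<epsilon>"
    using disc_cap[OF assms] by blast
  obtain d where d: "d > 0" "ball x d \<subseteq> - K"
    using K compact_imp_closed open_contains_ball[of "- K"] by (metis ComplI open_Compl)
  show thesis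
  proof
    show "0 < min d \<epsilon>" "min d \<epsilon> \<le> \<epsilon>" using d assms by auto
    fix a b assume ab: "a \<in> ball x (min d \<epsilon>) - \<Delta>" "b \<in> ball x (min d \<epsilon>) - \<Delta>"
    have "connected_component (- (\<Delta> \<union> (- ball x \<epsilon> \<union> K))) a b"
    proof (rule Janiszewski)
      show "compact \<Delta>" by (rule homeomorphic_cball_compact[OF hom])
      show "closed (- ball x \<epsilon> \<union> K)" using K compact_imp_closed by (auto simp: closed_Compl)
      have "\<Delta> \<inter> (- ball x \<epsilon> \<union> K) = K" using K by auto
      thus "connected (\<Delta> \<inter> (- ball x \<epsilon> \<union> K))" using K by simp
      show "connected_component (- \<Delta>) a b"
        unfolding connected_component_def using ab connected_complement_disc[OF hom] by blast
      show "connected_component (- (- ball x \<epsilon> \<union> K)) a b"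
        unfolding connected_component_def using ab d
        by (intro exI[of _ "ball x (min d \<epsilon>)"]) auto
    qed
    moreover have "- (\<Delta> \<union> (- ball x \<epsilon> \<union> K)) = ball x \<epsilon> - \<Delta>" using K by auto
    ultimately show "connected_component (ball x \<epsilon> - \<Delta>) a b" by simp
  qed
qed

lemma frontier_approx_outside:
  assumes "x \<in> frontier S" "closed S" "open U" "x \<in> U"
  obtains b where "b \<in> U" "b \<notin> S"
proof -
  have "\<not> U \<subseteq> S"
    using assms interior_maximal[of U S] unfolding frontier_def by blast
  thus thesis using that by blast
qed

section \<open>Complementary components near arcs and discs\<close>

text \<open>A connected set that leaves \<open>G\<close> meets the frontier of \<open>G\<close>,
  which lies in \<open>M\<close> and hence, by the hypothesis on the closure, in \<open>N\<close>.
  So the part of the barrier \<open>M\<close> that \<open>G\<close> does not touch may be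
  deleted.\<close>

lemma component_separates_smaller:
  fixes M N G :: "complex set"
  assumes "closed M" "G \<in> components (- M)" "N \<subseteq> M" "closure G \<inter> (M - N) = {}"
    and "a \<in> G" "connected_component (- N) a y"
  shows "y \<in> G"
proof (rule ccontr)
  assume "y \<notin> G"
  obtain C where C: "connected C" "C \<subseteq> - N" "a \<in> C" "y \<in> C"
    using assms(6) unfolding connected_component_def by blast
  have "C \<inter> G \<noteq> {}" "C - G \<noteq> {}" using C \<open>y \<notin> G\<close> assms(5) by auto
  hence "C \<inter> frontier G \<noteq> {}" using connected_Int_frontier[OF C(1)] by blast
  moreover have "frontier G \<subseteq> M"
    using frontier_of_components_closed_complement[OF assms(1,2)] .
  moreover have "frontier G \<subseteq> closure G" by (simp add: frontier_def)
  ultimately show False using C(2) assms(4) by blast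
qed

text \<open>With \<open>\<gamma> t\<close> the closure of \<open>G\<close> would miss a whole piece
  of the arc, from \<open>\<gamma> t1\<close> to \<open>\<gamma> t\<close>. Deleting it leaves
  \<open>stub\<close> and \<open>N1\<close>, which meet at most in \<open>\<gamma> 0\<close>;
  Janiszewski's theorem and \<open>component_separates_smaller\<close> then put the point
  \<open>\<gamma> v\<close> of the deleted piece into \<open>G\<close>.\<close>

lemma arc_in_closure_aux:
  fixes G N0 :: "complex set"
  assumes N0: "closed N0" and g: "arc \<gamma>" and meet: "path_image \<gamma> \<inter> N0 \<subseteq> {\<gamma> 0, \<gamma> 1}"
    and G: "G \<in> components (- (N0 \<union> path_image \<gamma>))"
    and st: "0 < s" "s < t" "t < 1" and cl: "\<gamma> s \<in> closure G"
  shows "\<gamma> t \<in> closure G"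
proof (rule ccontr)
  assume nt: "\<gamma> t \<notin> closure G"
  have cg: "continuous_on {0..1} \<gamma>" and inj: "inj_on \<gamma> {0..1}"
    using g by (auto simp: arc_def path_def)
  have "\<exists>d>0. \<forall>u\<in>{0..1}. dist u t < d \<longrightarrow> \<gamma> u \<in> - closure G"
  proof -
    obtain e where e: "e > 0" "ball (\<gamma> t) e \<subseteq> - closure G"
      using nt open_contains_ball[of "- closure G"] by auto
    obtain d where "d > 0" "\<And>u. u \<in> {0..1} \<Longrightarrow> dist u t < d \<Longrightarrow> dist (\<gamma> u) (\<gamma> t) < e"
      using cg[unfolded continuous_on_iff, rule_format, of t e] e st by auto
    thus ?thesis using e by (metis dist_commute mem_ball subsetD)
  qed
  then obtain d where d: "d > 0" "\<And>u. u \<in> {0..1} \<Longrightarrow> dist u t < d \<Longrightarrow> \<gamma> u \<notin> closure G"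
    by auto
  \<comment> \<open>The midpoint keeps \<open>t1\<close> to the right of \<open>s\<close>, and
    \<open>t - d / 2\<close> keeps it within \<open>d\<close> of \<open>t\<close>.\<close>
  define t1 where "t1 = max ((s + t) / 2) (t - d / 2)"
  have t1: "s < t1" "t1 < t"
    using d st by (auto simp: t1_def less_max_iff_disj)
  have t1d: "\<And>u. t1 \<le> u \<Longrightarrow> u \<le> t \<Longrightarrow> \<gamma> u \<notin> closure G"
    using d st by (auto simp: t1_def dist_real_def)
  define v where "v = (t1 + t) / 2"
  have v: "t1 < v" "v < t" using t1 by (auto simp: v_def)
  have inj': "\<And>x y. x \<in> {0..1} \<Longrightarrow> y \<in> {0..1} \<Longrightarrow> \<gamma> x = \<gamma> y \<Longrightarrow> x = y"
    using inj by (auto dest: inj_onD)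
  define stub where "stub = \<gamma> ` {0..t1}"
  define N1 where "N1 = N0 \<union> \<gamma> ` {t..1}"
  define M where "M = N0 \<union> path_image \<gamma>"
  have "arc (subpath 0 t1 \<gamma>)" using g st t1 by (intro arc_subpath_arc) (auto dest: inj')
  moreover have pis: "path_image (subpath 0 t1 \<gamma>) = stub"
    using st t1 by (simp add: stub_def path_image_subpath)
  ultimately have cst: "compact stub" and nsep: "connected (- stub)"
    using compact_arc_image connected_arc_complement[of "subpath 0 t1 \<gamma>"] by (metis compact_path_image arc_imp_path, simp)
  have "continuous_on {t..1} \<gamma>" using cg st by (auto intro: continuous_on_subset)
  hence "compact (\<gamma> ` {t..1})" by (intro compact_continuous_image) auto
  hence cN1: "closed N1" unfolding N1_def using N0 compact_imp_closed by blast
  have cM: "closed M" unfolding M_def using N0 g by (simp add: arc_imp_path closed_Un closed_path_image)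
  have offN0: "\<gamma> u \<notin> N0" if "0 < u" "u < 1" for u
  proof
    assume "\<gamma> u \<in> N0"
    moreover have "\<gamma> u \<in> path_image \<gamma>" using that by (simp add: path_image_def)
    ultimately have "\<gamma> u \<in> {\<gamma> 0, \<gamma> 1}" using meet by blast
    thus False using inj'[of u 0] inj'[of u 1] that by auto
  qed
  have offN1: "\<gamma> u \<notin> N1" if "0 < u" "u < t" for u
  proof -
    have "\<gamma> u \<noteq> \<gamma> x" if "x \<in> {t..1}" for x
      using inj'[of u x] that \<open>0 < u\<close> \<open>u < t\<close> st by auto
    hence "\<gamma> u \<notin> \<gamma> ` {t..1}" by (metis imageE)
    thus ?thesis using offN0[of u] that st by (simp add: N1_def)
  qed
  have meet1: "stub \<inter> N1 \<subseteq> {\<gamma> 0}"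
  proof
    fix z assume "z \<in> stub \<inter> N1"
    then obtain u where u: "z = \<gamma> u" "0 \<le> u" "u \<le> t1" "\<gamma> u \<in> N1" by (auto simp: stub_def)
    thus "z \<in> {\<gamma> 0}" using offN1[of u] t1 by force
  qed
  have "\<gamma> s \<notin> N1" using offN1 st by simp
  then obtain e where e: "e > 0" "ball (\<gamma> s) e \<subseteq> - N1"
    using cN1 open_contains_ball[of "- N1"] by auto
  obtain a where a: "a \<in> G" "a \<in> ball (\<gamma> s) e"
    using cl e by (auto simp: closure_approachable dist_commute)
  have GM: "G \<subseteq> - M" using G in_components_subset M_def by blast
  have vn: "\<gamma> v \<notin> stub" using v st t1 inj'[of v] by (fastforce simp: stub_def)
  have sub: "stub \<subseteq> path_image \<gamma>" unfolding stub_def path_image_def using t1 st by auto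
  have "connected_component (- (stub \<union> N1)) a (\<gamma> v)"
  proof (rule Janiszewski)
    show "connected (stub \<inter> N1)"
      using meet1 by (metis connected_empty connected_sing subset_singletonD)
    show "connected_component (- stub) a (\<gamma> v)"
      unfolding connected_component_def using nsep a GM sub vn by (intro exI[of _ "- stub"]) (auto simp: M_def)
    \<comment> \<open>Off \<open>N1\<close> the way from \<open>a\<close> leads to
      \<open>\<gamma> s\<close> and on along the arc itself; it may run through
      \<open>stub\<close>.\<close>
    have "connected_component (- N1) a (\<gamma> s)"
      unfolding connected_component_def using e a by (intro exI[of _ "ball (\<gamma> s) e"]) auto
    moreover have "connected_component (- N1) (\<gamma> s) (\<gamma> v)"
      unfolding connected_component_def
    proof (intro exI[of _ "\<gamma> ` {s..v}"] conjI)
      show "connected (\<gamma> ` {s..v})" using cg st v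
        by (intro connected_continuous_image) (auto intro: continuous_on_subset)
      show "\<gamma> ` {s..v} \<subseteq> - N1" using offN1 st v by auto
    qed (use t1 v in auto)
    ultimately show "connected_component (- N1) a (\<gamma> v)" by (rule connected_component_trans)
  qed (use cst cN1 in auto)
  moreover have "stub \<union> N1 \<subseteq> M"
    using sub st t1 by (auto simp: N1_def M_def path_image_def)
  moreover have "closure G \<inter> (M - (stub \<union> N1)) = {}"
  proof -
    have "z \<notin> closure G" if z: "z \<in> M" "z \<notin> stub" "z \<notin> N1" for z
    proof -
      obtain u where "u \<in> {0..1}" "z = \<gamma> u" using z by (auto simp: M_def N1_def path_image_def)
      with z have "t1 \<le> u" "u \<le> t" by (auto simp: stub_def N1_def)
      thus ?thesis using t1d \<open>z = \<gamma> u\<close> by simp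
    qed
    thus ?thesis by blast
  qed
  ultimately have "\<gamma> v \<in> G"
    using component_separates_smaller[OF cM, of G "stub \<union> N1" a "\<gamma> v"] G a by (simp add: M_def)
  thus False using t1d[of v] v closure_subset by fastforce
qed

text \<open>If the frontier of the component missed some point of the arc, the arc could be cut there;
  what remains attached to \<open>N0\<close> does not separate the plane further.\<close>
lemma arc_in_closure:
  fixes G N0 :: "complex set"
  assumes N0: "closed N0" and g: "arc \<gamma>" and meet: "path_image \<gamma> \<inter> N0 \<subseteq> {\<gamma> 0, \<gamma> 1}"
    and G: "G \<in> components (- (N0 \<union> path_image \<gamma>))"
    and s: "0 < s" "s < 1" and cl: "\<gamma> s \<in> closure G"
  shows "path_image \<gamma> \<subseteq> closure G"
proof -
  have open_part: "\<gamma> t \<in> closure G" if t: "0 < t" "t < 1" for t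
  proof (cases s t rule: linorder_cases)
    case less
    thus ?thesis using arc_in_closure_aux[OF N0 g meet G] s t cl by blast
  next
    case greater
    have "reversepath \<gamma> (1 - t) \<in> closure G"
    proof (rule arc_in_closure_aux[OF N0, of "reversepath \<gamma>" G "1 - s"])
      show "arc (reversepath \<gamma>)" using g by (simp add: arc_reversepath)
      show "path_image (reversepath \<gamma>) \<inter> N0 \<subseteq> {reversepath \<gamma> 0, reversepath \<gamma> 1}"
        using meet unfolding path_image_reversepath by (auto simp: reversepath_def)
      show "G \<in> components (- (N0 \<union> path_image (reversepath \<gamma>)))" using G by simp
    qed (use s t greater cl in \<open>auto simp: reversepath_def\<close>)
    thus ?thesis by (simp add: reversepath_def)
  qed (use cl in simp)
  have "path_image \<gamma> = \<gamma> ` closure {0<..<1}" by (simp add: path_image_def)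
  also have "\<dots> \<subseteq> closure (\<gamma> ` {0<..<1})"
    using g by (intro image_closure_subset) (auto simp: arc_def path_def closure_subset)
  also have "\<dots> \<subseteq> closure G" using open_part by (intro closure_minimal) auto
  finally show ?thesis .
qed

text \<open>By \<open>arc_in_closure\<close>, a failure means that the closure of \<open>G\<close>
  misses the whole open arc, which can then be deleted from the barrier. Near
  \<open>\<gamma> 0\<close>, points of \<open>G\<close> and the first points of the arc both lie
  just outside \<Delta>, where the complement is locally connected, so the arc would enter
  \<open>G\<close>.\<close>

lemma arc_from_disc_in_closure:
  fixes \<Delta> rest G :: "complex set"
  assumes hom: "\<Delta> homeomorphic (cball 0 1 :: complex set)" and rest: "closed rest" "\<gamma> 0 \<notin> rest"
    and g: "arc \<gamma>" and meet: "path_image \<gamma> \<inter> (\<Delta> \<union> rest) \<subseteq> {\<gamma> 0, \<gamma> 1}"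
    and G: "G \<in> components (- (\<Delta> \<union> rest \<union> path_image \<gamma>))"
    and q: "\<gamma> 0 \<in> frontier \<Delta>" "\<gamma> 0 \<in> closure G" and one: "\<gamma> 1 \<in> \<Delta> \<union> rest"
  shows "path_image \<gamma> \<subseteq> closure G"
proof (rule ccontr)
  assume n: "\<not> path_image \<gamma> \<subseteq> closure G"
  define M where "M = \<Delta> \<union> rest \<union> path_image \<gamma>"
  have cD: "closed \<Delta>" using homeomorphic_cball_compact[OF hom] compact_imp_closed by blast
  have cl0: "closed (\<Delta> \<union> rest)" using cD rest by auto
  have inj': "\<And>x y. x \<in> {0..1} \<Longrightarrow> y \<in> {0..1} \<Longrightarrow> \<gamma> x = \<gamma> y \<Longrightarrow> x = y"
    using g by (auto simp: arc_def dest: inj_onD)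
  have off: "\<gamma> s \<notin> closure G" if "0 < s" "s < 1" for s
    using arc_in_closure[OF cl0 g meet G that] n by blast
  have off0: "\<gamma> s \<notin> \<Delta> \<union> rest" if "0 < s" "s < 1" for s
  proof
    assume "\<gamma> s \<in> \<Delta> \<union> rest"
    moreover have "\<gamma> s \<in> path_image \<gamma>" using that by (simp add: path_image_def)
    ultimately have "\<gamma> s \<in> {\<gamma> 0, \<gamma> 1}" using meet by blast
    thus False using inj'[of s 0] inj'[of s 1] that by auto
  qed
  obtain \<epsilon> where \<epsilon>: "\<epsilon> > 0" "ball (\<gamma> 0) \<epsilon> \<subseteq> - rest"
    using rest open_contains_ball[of "- rest"] by auto
  obtain \<delta> where \<delta>: "\<delta> > 0" "\<And>a b. a \<in> ball (\<gamma> 0) \<delta> - \<Delta> \<Longrightarrow> b \<in> ball (\<gamma> 0) \<delta> - \<Delta> \<Longrightarrow>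
      connected_component (ball (\<gamma> 0) \<epsilon> - \<Delta>) a b"
    using disc_complement_locally_connected[OF hom q(1) \<epsilon>(1)] by metis
  obtain a where a: "a \<in> G" "a \<in> ball (\<gamma> 0) \<delta>"
    using q(2) \<delta> by (auto simp: closure_approachable dist_commute)
  have GM: "G \<subseteq> - M" using G in_components_subset M_def by blast
  obtain d where d: "d > 0" "\<And>u. u \<in> {0..1} \<Longrightarrow> dist u 0 < d \<Longrightarrow> dist (\<gamma> u) (\<gamma> 0) < \<delta>"
    using g[unfolded arc_def path_def continuous_on_iff] \<delta>(1) by (meson atLeastAtMost_iff order_refl zero_le_one)
  define s where "s = min (d / 2) (1 / 2)"
  have s: "0 < s" "s < 1" "s < d" using d by (auto simp: s_def)
  have ys: "\<gamma> s \<in> ball (\<gamma> 0) \<delta> - \<Delta>" using d(2)[of s] s off0[of s] by (auto simp: dist_commute)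
  have "connected_component (ball (\<gamma> 0) \<epsilon> - \<Delta>) a (\<gamma> s)"
    using \<delta>(2)[OF _ ys] a GM by (auto simp: M_def)
  hence "connected_component (- (\<Delta> \<union> rest)) a (\<gamma> s)"
    by (rule connected_component_of_subset) (use \<epsilon> in auto)
  moreover have "closure G \<inter> (M - (\<Delta> \<union> rest)) = {}"
  proof -
    have "z \<notin> closure G" if z: "z \<in> path_image \<gamma>" "z \<notin> \<Delta> \<union> rest" for z
    proof -
      obtain u where u: "u \<in> {0..1}" "z = \<gamma> u" using z by (auto simp: path_image_def)
      have "u \<noteq> 0" using z u q(1) cD frontier_subset_eq by blast
      moreover have "u \<noteq> 1" using z u one by blast
      ultimately show ?thesis using off u by force
    qed
    thus ?thesis by (auto simp: M_def)
  qed
  ultimately have "\<gamma> s \<in> G"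
    using component_separates_smaller[of M G "\<Delta> \<union> rest" a "\<gamma> s"] G a cl0 g
    by (auto simp: M_def closed_Un arc_imp_path closed_path_image)
  thus False using off[of s] s closure_subset by fastforce
qed

text \<open>If the frontier of the component met the disc near the end of the arc only in that end, a cap
  of the disc there could be removed, which leaves the arc attached only at its other end.\<close>
lemma closure_meets_disc_at_arc_end:
  fixes \<Delta> rest G :: "complex set"
  assumes hom: "\<Delta> homeomorphic (cball 0 1 :: complex set)" and rest: "closed rest" "\<gamma> 1 \<notin> rest"
    and g: "arc \<gamma>" and meet: "path_image \<gamma> \<inter> (\<Delta> \<union> rest) \<subseteq> {\<gamma> 0, \<gamma> 1}"
    and G: "G \<in> components (- (\<Delta> \<union> rest \<union> path_image \<gamma>))"
    and p: "\<gamma> 1 \<in> frontier \<Delta>" "\<gamma> 1 \<in> closure G" and "0 < \<epsilon>"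
  obtains z where "z \<in> frontier \<Delta>" "z \<in> ball (\<gamma> 1) \<epsilon>" "z \<noteq> \<gamma> 1" "z \<in> closure G"
proof (rule ccontr)
  assume "\<not> thesis"
  hence none: "z \<notin> closure G" if "z \<in> frontier \<Delta>" "z \<in> ball (\<gamma> 1) \<epsilon>" "z \<noteq> \<gamma> 1" for z
    using that \<open>\<And>z. \<lbrakk>z \<in> frontier \<Delta>; z \<in> ball (\<gamma> 1) \<epsilon>; z \<noteq> \<gamma> 1; z \<in> closure G\<rbrakk> \<Longrightarrow> thesis\<close> by blast
  define M where "M = \<Delta> \<union> rest \<union> path_image \<gamma>"
  have compD: "compact \<Delta>" using homeomorphic_cball_compact[OF hom] .
  hence cD: "closed \<Delta>" by (rule compact_imp_closed)
  have cM: "closed M" using cD rest g by (auto simp: M_def closed_Un arc_imp_path closed_path_image)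
  have ne: "\<gamma> 0 \<noteq> \<gamma> 1" using g by (metis arc_distinct_ends pathstart_def pathfinish_def)
  define \<eta> where "\<eta> = min \<epsilon> (dist (\<gamma> 1) (\<gamma> 0))"
  have "\<eta> > 0" using \<open>0 < \<epsilon>\<close> ne by (simp add: \<eta>_def)
  obtain K where K: "compact K" "connected K" "K \<subseteq> \<Delta>" "\<gamma> 1 \<notin> K" "\<Delta> - K \<subseteq> ball (\<gamma> 1) \<eta>"
    using disc_cap[OF hom p(1) \<open>\<eta> > 0\<close>] by blast
  define N1 where "N1 = K \<union> rest"
  have cN1: "closed N1" using K rest compact_imp_closed by (auto simp: N1_def)
  have "\<gamma> 1 \<notin> N1" using K rest by (auto simp: N1_def)
  then obtain \<delta> where \<delta>: "\<delta> > 0" "ball (\<gamma> 1) \<delta> \<subseteq> - N1"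
    using cN1 open_contains_ball[of "- N1"] by auto
  obtain a where a: "a \<in> G" "a \<in> ball (\<gamma> 1) \<delta>"
    using p(2) \<delta> by (auto simp: closure_approachable dist_commute)
  have GM: "G \<subseteq> - M" using G in_components_subset M_def by blast
  have oG: "open G" using G cM open_components[of "- M" G] unfolding M_def by blast
  have pD: "\<gamma> 1 \<in> \<Delta>" using p(1) cD frontier_subset_eq by blast
  have "\<gamma> 1 islimpt \<Delta>"
  proof (rule connected_imp_perfect)
    show "connected \<Delta>" using hom homeomorphic_connectedness by (metis connected_cball)
    show "\<Delta> \<noteq> {x}" for x
      using infinite_frontier_disc[OF hom] frontier_subset_eq[of \<Delta>] cD finite_subset by auto
  qed (use pD in auto)
  \<comment> \<open>\<open>y\<close> is a point of the removed cap: it is nearer to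
    \<open>\<gamma> 1\<close> than \<open>\<gamma> 0\<close> is, hence not on the arc, and nearer
    than \<delta>, hence off \<open>K\<close>. Joining it to \<open>G\<close> is the contradiction,
    since it belongs to \<Delta>.\<close>
  then obtain y where y: "y \<in> \<Delta>" "y \<noteq> \<gamma> 1" "y \<in> ball (\<gamma> 1) (min \<delta> (dist (\<gamma> 1) (\<gamma> 0)))"
    using \<delta> ne unfolding islimpt_approachable by (metis dist_commute mem_ball min_less_iff_conj zero_less_dist_iff)
  have y1: "y \<in> ball (\<gamma> 1) \<delta>" "y \<noteq> \<gamma> 0" using y(3) by auto
  have yg: "y \<notin> path_image \<gamma>" using meet y y1 by auto
  have "connected_component (- (path_image \<gamma> \<union> N1)) a y"
  proof (rule Janiszewski)
    show "compact (path_image \<gamma>)" using g by (simp add: arc_imp_path compact_path_image)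
    have "path_image \<gamma> \<inter> N1 \<subseteq> {\<gamma> 0}" using meet K \<open>\<gamma> 1 \<notin> N1\<close> by (auto simp: N1_def)
    thus "connected (path_image \<gamma> \<inter> N1)"
      by (metis connected_empty connected_sing subset_singletonD)
    show "connected_component (- path_image \<gamma>) a y"
      unfolding connected_component_def
      using connected_arc_complement[OF g] a GM yg by (intro exI[of _ "- path_image \<gamma>"]) (auto simp: M_def)
    show "connected_component (- N1) a y"
      unfolding connected_component_def using \<delta> a y1 by (intro exI[of _ "ball (\<gamma> 1) \<delta>"]) auto
  qed (rule cN1)
  moreover have "path_image \<gamma> \<union> N1 \<subseteq> M" using K by (auto simp: M_def N1_def)
  moreover have "closure G \<inter> (M - (path_image \<gamma> \<union> N1)) = {}"
  proof -
    have "z \<notin> closure G" if z: "z \<in> \<Delta>" "z \<notin> K" "z \<notin> path_image \<gamma>" for z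
    proof (cases "z \<in> frontier \<Delta>")
      case True
      moreover have "z \<in> ball (\<gamma> 1) \<epsilon>" using z K(5) by (auto simp: \<eta>_def)
      moreover have "z \<noteq> \<gamma> 1" using z(3) by (auto simp: path_image_def)
      ultimately show ?thesis using none by blast
    next
      case False
      hence "z \<in> interior \<Delta>" using z(1) cD by (simp add: frontier_def)
      moreover have "interior \<Delta> \<inter> G = {}" using GM interior_subset[of \<Delta>] by (auto simp: M_def)
      hence "interior \<Delta> \<inter> closure G = {}" by (simp add: open_Int_closure_eq_empty)
      ultimately show ?thesis by blast
    qed
    thus ?thesis by (auto simp: M_def N1_def)
  qed
  ultimately have "y \<in> G"
    using component_separates_smaller[OF cM, of G "path_image \<gamma> \<union> N1" a y] G a by (simp add: M_def)
  thus False using GM y by (auto simp: M_def)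
qed

text \<open>Lying in the closure of \<open>G\<close> is locally constant along \<open>C\<close>:
  near a point off \<open>rest\<close>, points outside \<Delta> are joined outside \<Delta> by
  \<open>disc_complement_locally_connected\<close>, so those close to two neighbouring frontier
  points belong to the same component.\<close>

lemma frontier_connected_in_closure:
  fixes \<Delta> rest G :: "complex set"
  assumes hom: "\<Delta> homeomorphic (cball 0 1 :: complex set)" and rest: "closed rest"
    and G: "G \<in> components (- (\<Delta> \<union> rest))"
    and C: "connected C" "C \<subseteq> frontier \<Delta>" "C \<inter> rest = {}" and x: "x \<in> C" "x \<in> closure G"
  shows "C \<subseteq> closure G"
proof
  fix y assume "y \<in> C"
  have cD: "closed \<Delta>" using homeomorphic_cball_compact[OF hom] compact_imp_closed by blast
  have GM: "G \<subseteq> - (\<Delta> \<union> rest)" using G in_components_subset by blast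
  show "y \<in> closure G"
  proof (rule connected_induction_simple[OF C(1) x(1) \<open>y \<in> C\<close>, of "\<lambda>z. z \<in> closure G", OF x(2)])
    fix c assume c: "c \<in> C"
    then obtain \<epsilon> where \<epsilon>: "\<epsilon> > 0" "ball c \<epsilon> \<subseteq> - rest"
      using rest C open_contains_ball[of "- rest"] by (metis ComplI IntI empty_iff open_Compl)
    obtain \<delta> where \<delta>: "\<delta> > 0" "\<And>a b. a \<in> ball c \<delta> - \<Delta> \<Longrightarrow> b \<in> ball c \<delta> - \<Delta> \<Longrightarrow>
        connected_component (ball c \<epsilon> - \<Delta>) a b"
      using disc_complement_locally_connected[OF hom _ \<epsilon>(1), of c] C c by (metis subsetD)
    have "v \<in> closure G" if u: "u \<in> ball c \<delta>" "u \<in> closure G" and v: "v \<in> C" "v \<in> ball c \<delta>" for u v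
    proof -
      obtain a where a: "a \<in> G" "a \<in> ball c \<delta>"
        using u by (meson IntI disjoint_iff open_Int_closure_eq_empty open_ball)
      have "\<exists>b\<in>G. b \<in> T" if T: "open T" "v \<in> T" for T
      proof -
        obtain b where b: "b \<in> T \<inter> ball c \<delta>" "b \<notin> \<Delta>"
          using frontier_approx_outside[of v \<Delta> "T \<inter> ball c \<delta>"] v T C cD by auto
        have "connected_component (ball c \<epsilon> - \<Delta>) a b" using \<delta>(2) a b GM by blast
        hence "connected_component (- (\<Delta> \<union> rest)) a b"
          by (rule connected_component_of_subset) (use \<epsilon> in auto)
        hence "b \<in> G"
          using G a(1) by (metis componentsE connected_component_eq mem_Collect_eq)
        thus ?thesis using b by blast
      qed
      thus ?thesis unfolding closure_iff_nhds_not_empty by blast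
    qed
    thus "\<exists>T. openin (top_of_set C) T \<and> c \<in> T \<and> (\<forall>u\<in>T. \<forall>v\<in>T. u \<in> closure G \<longrightarrow> v \<in> closure G)"
    proof (intro exI conjI)
      show "openin (top_of_set C) (C \<inter> ball c \<delta>)" by (simp add: openin_open_Int)
      show "c \<in> C \<inter> ball c \<delta>" using c \<delta>(1) by simp
    qed blast
  qed
qed

text \<open>Points outside \<Delta> accumulate at \<open>x\<close>, and by local connectedness the
  nearby ones share one component; infinitely many components cannot alternate towards
  \<open>x\<close>.\<close>

lemma frontier_point_in_closure:
  fixes \<Delta> rest :: "complex set"
  assumes hom: "\<Delta> homeomorphic (cball 0 1 :: complex set)" and rest: "closed rest"
    and x: "x \<in> frontier \<Delta>" "x \<notin> rest"
  obtains G where "G \<in> components (- (\<Delta> \<union> rest))" "x \<in> closure G"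
proof -
  have cD: "closed \<Delta>" using homeomorphic_cball_compact[OF hom] compact_imp_closed by blast
  obtain \<epsilon> where \<epsilon>: "\<epsilon> > 0" "ball x \<epsilon> \<subseteq> - rest"
    using rest x open_contains_ball[of "- rest"] by auto
  obtain \<delta> where \<delta>: "\<delta> > 0" "\<delta> \<le> \<epsilon>" "\<And>a b. a \<in> ball x \<delta> - \<Delta> \<Longrightarrow> b \<in> ball x \<delta> - \<Delta> \<Longrightarrow>
      connected_component (ball x \<epsilon> - \<Delta>) a b"
    using disc_complement_locally_connected[OF hom x(1) \<epsilon>(1)] by metis
  obtain a where a: "a \<in> ball x \<delta>" "a \<notin> \<Delta>"
    using frontier_approx_outside[of x \<Delta> "ball x \<delta>"] x cD \<delta> by auto
  define G where "G = connected_component_set (- (\<Delta> \<union> rest)) a"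
  have "ball x \<delta> \<subseteq> ball x \<epsilon>" using \<delta>(2) by (rule subset_ball)
  hence "a \<in> - (\<Delta> \<union> rest)" using a \<epsilon>(2) by blast
  hence "G \<in> components (- (\<Delta> \<union> rest))" unfolding G_def by (rule componentsI)
  moreover have "\<exists>b\<in>G. b \<in> T" if T: "open T" "x \<in> T" for T
  proof -
    obtain b where b: "b \<in> T \<inter> ball x \<delta>" "b \<notin> \<Delta>"
      using frontier_approx_outside[of x \<Delta> "T \<inter> ball x \<delta>"] x T cD \<delta> by auto
    have "connected_component (ball x \<epsilon> - \<Delta>) a b" using \<delta>(3) a b by blast
    hence "connected_component (- (\<Delta> \<union> rest)) a b"
      by (rule connected_component_of_subset) (use \<epsilon> in auto)
    thus ?thesis using b by (auto simp: G_def)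
  qed
  hence "x \<in> closure G" unfolding closure_iff_nhds_not_empty by blast
  ultimately show thesis using that by blast
qed

text \<open>\<open>f\<close> is the radial retraction onto the closed unit disc; it sends outer
  points to the unit circle, which misses \<open>M\<close>. This is the passage from components in
  the plane to regions, which are components in the disc.\<close>

lemma connected_component_cball:
  fixes M :: "complex set"
  assumes M: "M \<subseteq> ball 0 1" and con: "connected_component (- M) a b" and ab: "a \<in> cball 0 1" "b \<in> cball 0 1"
  shows "connected_component (cball 0 1 - M) a b"
proof -
  obtain T where T: "connected T" "T \<subseteq> - M" "a \<in> T" "b \<in> T"
    using con unfolding connected_component_def by blast
  define f where "f x = (1 / max 1 (norm x)) *\<^sub>R x" for x :: complex
  have "continuous_on T f"
    unfolding f_def by (intro continuous_intros) auto
  hence "connected (f ` T)" using T(1) connected_continuous_image by blast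
  moreover have "f x \<in> cball 0 1 - M" if "x \<in> T" for x
  proof (cases "norm x \<le> 1")
    case True
    thus ?thesis using that T(2) by (auto simp: f_def max_def)
  next
    case False
    hence "x \<noteq> 0" "max 1 (norm x) = norm x" by auto
    hence "norm (f x) = 1" by (simp add: f_def)
    thus ?thesis using M by auto
  qed
  moreover have "f a = a" "f b = b" using ab by (auto simp: f_def max_def)
  ultimately show ?thesis
    unfolding connected_component_def using T(3,4) by (intro exI[of _ "f ` T"]) (auto simp: image_iff, metis+)
qed

section \<open>Winding numbers\<close>

lemma disc_raysD:
  assumes "disc_rays \<Delta> m ray" "x \<in> frontier \<Delta>"
  shows "path (ray x)" "pathstart (ray x) = m" "pathfinish (ray x) = x"
    and "path_image (ray x) \<subseteq> insert x (interior \<Delta>)"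
proof -
  have ct: "continuous_on (frontier \<Delta> \<times> {0..1}) (\<lambda>(x, t). ray x t)"
    and r: "ray x 0 = m" "ray x 1 = x" "\<And>t. 0 \<le> t \<Longrightarrow> t < 1 \<Longrightarrow> ray x t \<in> interior \<Delta>"
    using assms unfolding disc_rays_def by blast+
  have "continuous_on {0..1} ((\<lambda>(x, t). ray x t) \<circ> (\<lambda>t. (x, t)))"
    by (rule continuous_on_compose)
      (use assms(2) in \<open>auto intro!: continuous_intros continuous_on_subset[OF ct]\<close>)
  thus "path (ray x)" by (simp add: path_def o_def)
  show "pathstart (ray x) = m" "pathfinish (ray x) = x"
    using r by (auto simp: pathstart_def pathfinish_def)
  have "ray x t \<in> insert x (interior \<Delta>)" if "t \<in> {0..1}" for t
    using r(2) r(3)[of t] that by (cases "t = 1") auto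
  thus "path_image (ray x) \<subseteq> insert x (interior \<Delta>)" unfolding path_image_def by blast
qed

lemma disc_rays_notin:
  assumes "disc_rays \<Delta> m ray" "x \<in> frontier \<Delta>" "y \<in> frontier \<Delta>" "x \<noteq> y" "0 < s" "s \<le> 1"
  shows "ray x s \<notin> path_image (ray y)"
proof
  assume "ray x s \<in> path_image (ray y)"
  then obtain t where "0 \<le> t" "t \<le> 1" "ray x s = ray y t" unfolding path_image_def by auto
  thus False using assms unfolding disc_rays_def by blast
qed

lemma disc_rays_interior:
  assumes "disc_rays \<Delta> m ray" "x \<in> frontier \<Delta>" "0 \<le> t" "t < 1"
  shows "ray x t \<in> interior \<Delta>"
  using assms unfolding disc_rays_def by blast

text \<open>A small ball about \<open>z\<close> misses the loop and contains points off \<Delta>;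
  from there the connected unbounded complement of \<Delta> leads to infinity.\<close>

lemma loop_in_disc_winding_zero:
  fixes \<Delta> :: "complex set"
  assumes hom: "\<Delta> homeomorphic (cball 0 1 :: complex set)" and L: "path L" "pathfinish L = pathstart L"
    and sub: "path_image L \<subseteq> \<Delta>" and z: "z \<in> frontier \<Delta>" "z \<notin> path_image L"
  shows "winding_number L z = 0"
proof (rule winding_number_zero_in_outside[OF L])
  have comp: "compact \<Delta>" using homeomorphic_cball_compact[OF hom] .
  have "open (- path_image L)" using L(1) closed_path_image by blast
  then obtain e where e: "e > 0" "ball z e \<subseteq> - path_image L"
    using z(2) open_contains_ball by blast
  obtain b where b: "b \<in> ball z e" "b \<notin> \<Delta>"
    using frontier_approx_outside[of z \<Delta> "ball z e"] z(1) comp e compact_imp_closed by auto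
  have conn: "connected (ball z e \<union> (- \<Delta>))"
    by (rule connected_Un) (use connected_complement_disc[OF hom] b in auto)
  have "ball z e \<union> (- \<Delta>) \<subseteq> connected_component_set (- path_image L) z"
    using conn e sub by (intro connected_component_maximal) auto
  moreover have "\<not> bounded (- \<Delta>)"
    using comp compact_imp_bounded cobounded_imp_unbounded[of "- \<Delta>"] by auto
  ultimately show "z \<in> outside (path_image L)"
    by (auto simp: outside dest: bounded_subset)
qed

text \<open>\<open>V\<close> is the winding number of the clockwise boundary of the sector of
  \<Delta> between the rays to \<open>c s\<close> and \<open>c t'\<close>. The ray to
  \<open>c t2\<close> lies in the sector, the ray to \<open>c t1\<close> outside, and 1/2 is just an
  interior radius.\<close>

lemma sector_winding_numbers:
  assumes hom: "\<Delta> homeomorphic (cball 0 1 :: complex set)" and rays: "disc_rays \<Delta> m ray"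
    and cw: "clockwise_boundary \<Delta> c" and t: "0 < t1" "t1 < s" "s < t2" "t2 < t'" "t' < 1"
  defines "V \<equiv> \<lambda>z. winding_number (ray (c s)) z + winding_number (subpath s t' c) z
                    - winding_number (ray (c t')) z"
  shows "V (ray (c t2) (1/2)) = -1" and "V (ray (c t1) (1/2)) = 0"
proof -
  have c: "simple_path c" "pathfinish c = pathstart c" "path_image c = frontier \<Delta>"
    "\<And>z. z \<in> interior \<Delta> \<Longrightarrow> winding_number c z = -1"
    using cw by (auto simp: clockwise_boundary_def)
  have pc: "path c" using c(1) by (rule simple_path_imp_path)
  have cf: "c u \<in> frontier \<Delta>" if "0 \<le> u" "u \<le> 1" for u
    using c(3) that by (auto simp: path_image_def)
  have cinj: "u = v" if "c u = c v" "0 \<le> u" "u \<le> 1" "0 < v" "v < 1" for u v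
    using c(1) that unfolding simple_path_def loop_free_def by (metis atLeastAtMost_iff less_irrefl less_imp_le)
  have frD: "frontier \<Delta> \<subseteq> \<Delta>"
    using homeomorphic_cball_compact[OF hom] compact_imp_closed frontier_subset_eq by blast
  have fint: "x \<notin> interior \<Delta>" if "x \<in> frontier \<Delta>" for x
    using that by (simp add: frontier_def)
  have fs: "c s \<in> frontier \<Delta>" and ft': "c t' \<in> frontier \<Delta>" and ft1: "c t1 \<in> frontier \<Delta>"
    and ft2: "c t2 \<in> frontier \<Delta>" using cf t by auto
  note rs = disc_raysD[OF rays fs] and rt' = disc_raysD[OF rays ft']
  have psub: "path_image (subpath u v c) = c ` {u..v}" if "u \<le> v" for u v
    using that by (simp add: path_image_subpath)
  have off_boundary: "ray x (1/2) \<notin> path_image (subpath u v c)"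
    if "x \<in> frontier \<Delta>" "u \<in> {0..1}" "v \<in> {0..1}" for x u v
  proof -
    have "path_image (subpath u v c) \<subseteq> frontier \<Delta>" using path_image_subpath_subset c(3) that by metis
    thus ?thesis using fint disc_rays_interior[OF rays that(1), of "1/2"] by auto
  qed
  have rayD: "path_image (ray x) \<subseteq> \<Delta>" if "x \<in> frontier \<Delta>" for x
    using disc_raysD(4)[OF rays that] interior_subset[of \<Delta>] that frD by blast
  have subD: "path_image (subpath u v c) \<subseteq> \<Delta>" if "u \<in> {0..1}" "v \<in> {0..1}" for u v
    using path_image_subpath_subset[OF that, of c] c(3) frD by blast
  \<comment> \<open>\<open>L1\<close> bounds the sector and \<open>L2\<close> the complementary one,
    so their winding numbers add up to that of \<open>c\<close>. The value -1 inside the first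
    sector is therefore obtained from the value 0 of \<open>L2\<close>.\<close>
  define L1 where "L1 = ray (c s) +++ (subpath s t' c +++ reversepath (ray (c t')))"
  define L2 where "L2 = ray (c t') +++ (subpath t' 1 c +++ (subpath 0 s c +++ reversepath (ray (c s))))"
  have L1: "path L1" "pathstart L1 = m" "pathfinish L1 = m"
    "path_image L1 = path_image (ray (c s)) \<union> c ` {s..t'} \<union> path_image (ray (c t'))"
    unfolding L1_def using rs rt' pc t psub[of s t'] by (auto simp: path_image_join)
  have c10: "c 1 = c 0" using c(2) by (simp add: pathstart_def pathfinish_def)
  have L2: "path L2" "pathstart L2 = m" "pathfinish L2 = m"
    "path_image L2 = path_image (ray (c s)) \<union> c ` {0..s} \<union> c ` {t'..1} \<union> path_image (ray (c t'))"
    unfolding L2_def using rs rt' pc t c10 psub[of 0 s] psub[of t' 1]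
    by (auto simp: path_image_join)
  have W1: "winding_number L1 z = V z" if "z \<notin> path_image L1" for z
    using that rs rt' pc t psub[of s t'] unfolding L1(4)
    by (auto simp: L1_def V_def winding_number_join winding_number_reversepath path_image_join)
  have W2: "winding_number L2 z = winding_number (ray (c t')) z + winding_number (subpath t' 1 c) z
      + winding_number (subpath 0 s c) z - winding_number (ray (c s)) z" if "z \<notin> path_image L2" for z
    using that rs rt' pc t psub[of 0 s] psub[of t' 1] c10 unfolding L2(4)
    by (auto simp: L2_def winding_number_join winding_number_reversepath path_image_join)
  have L1D: "path_image L1 \<subseteq> \<Delta>" and L2D: "path_image L2 \<subseteq> \<Delta>"
    using rayD[OF fs] rayD[OF ft'] subD[of s t'] subD[of 0 s] subD[of t' 1] psub[of s t'] psub[of 0 s] psub[of t' 1] t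
    unfolding L1(4) L2(4) by auto
  text \<open>The outer half of a ray leads to a frontier point off the loop.\<close>
  have zero: "winding_number L (ray x (1/2)) = 0"
    if L: "path L" "pathstart L = m" "pathfinish L = m" "path_image L \<subseteq> \<Delta>" and x: "x \<in> frontier \<Delta>"
      and off: "\<And>t. 1/2 \<le> t \<Longrightarrow> t \<le> 1 \<Longrightarrow> ray x t \<notin> path_image L" for L x
  proof -
    have "connected (ray x ` {1/2..1})"
      using disc_raysD(1)[OF rays x] unfolding path_def
      by (intro connected_continuous_image) (auto intro: continuous_on_subset)
    hence "winding_number L (ray x (1/2)) = winding_number L (ray x 1)"
      using L off by (intro winding_number_eq[of L _ "ray x ` {1/2..1}"]) auto
    also have "ray x 1 = x" using disc_raysD(3)[OF rays x] by (simp add: pathfinish_def)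
    also have "winding_number L x = 0"
      using L x off[of 1] \<open>ray x 1 = x\<close> by (intro loop_in_disc_winding_zero[OF hom]) auto
    finally show ?thesis .
  qed
  have off1: "ray (c t1) u \<notin> path_image L1" if "1/2 \<le> u" "u \<le> 1" for u
  proof -
    have "ray (c t1) u \<notin> path_image (ray (c s))" "ray (c t1) u \<notin> path_image (ray (c t'))"
      using disc_rays_notin[OF rays ft1 fs _, of u] disc_rays_notin[OF rays ft1 ft' _, of u] that
        cinj[of t1 s] cinj[of t1 t'] t by auto
    moreover have "ray (c t1) u \<notin> c ` {s..t'}"
    proof (cases "u = 1")
      case True
      hence "ray (c t1) u = c t1" using disc_raysD(3)[OF rays ft1] by (simp add: pathfinish_def)
      thus ?thesis using cinj[of _ t1] t by fastforce
    next
      case False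
      thus ?thesis using disc_rays_interior[OF rays ft1, of u] that fint cf t by fastforce
    qed
    ultimately show ?thesis by (simp add: L1(4))
  qed
  have off2: "ray (c t2) u \<notin> path_image L2" if "1/2 \<le> u" "u \<le> 1" for u
  proof -
    have "ray (c t2) u \<notin> path_image (ray (c s))" "ray (c t2) u \<notin> path_image (ray (c t'))"
      using disc_rays_notin[OF rays ft2 fs _, of u] disc_rays_notin[OF rays ft2 ft' _, of u] that
        cinj[of t2 s] cinj[of t2 t'] t by auto
    moreover have "ray (c t2) u \<notin> c ` {0..s} \<union> c ` {t'..1}"
    proof (cases "u = 1")
      case True
      hence "ray (c t2) u = c t2" using disc_raysD(3)[OF rays ft2] by (simp add: pathfinish_def)
      thus ?thesis using cinj[of _ t2] t by fastforce
    next
      case False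
      thus ?thesis using disc_rays_interior[OF rays ft2, of u] that fint cf t by fastforce
    qed
    ultimately show ?thesis by (simp add: L2(4))
  qed
  show "V (ray (c t1) (1/2)) = 0"
    using W1[of "ray (c t1) (1/2)"] zero[OF L1(1-3) L1D ft1 off1] off1[of "1/2"] by simp
  let ?z = "ray (c t2) (1/2)"
  have zi: "?z \<in> interior \<Delta>" using disc_rays_interior[OF rays ft2, of "1/2"] by simp
  have zc: "?z \<notin> path_image c" using zi fint c(3) by auto
  have "winding_number (subpath 0 s c) ?z + winding_number (subpath s t' c) ?z
      + winding_number (subpath t' 1 c) ?z = winding_number (subpath 0 1 c) ?z"
    using winding_number_subpath_combine[OF pc zc, of 0 s t'] winding_number_subpath_combine[OF pc zc, of 0 t' 1] t
    by simp
  also have "\<dots> = -1" using c(4)[OF zi] by simp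
  finally show "V ?z = -1"
    using W2[of ?z] zero[OF L2(1-3) L2D ft2 off2] off2[of "1/2"] by (simp add: V_def algebra_simps)
qed

text \<open>A branch of the logarithm, divided by 2 pi i. Its jumps along the cut are integers, so
  modulo integers the winding number of a path that need not be closed is the difference of the
  values at its ends.\<close>

definition log_mod :: "complex \<Rightarrow> complex \<Rightarrow> complex" where
  "log_mod z p = Ln (p - z) / (2 * pi * \<i>)"

lemma winding_number_log_mod:
  assumes "path p" "z \<notin> path_image p"
  shows "winding_number p z - (log_mod z (pathfinish p) - log_mod z (pathstart p)) \<in> \<int>"
proof -
  have ne: "pathfinish p - z \<noteq> 0" "pathstart p - z \<noteq> 0"
    using assms by (metis eq_iff_diff_eq_0 pathfinish_in_path_image pathstart_in_path_image)+
  have "exp (Ln (pathfinish p - z)) = exp (2 * pi * \<i> * winding_number p z + Ln (pathstart p - z))"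
    using winding_number_exp_2pi[OF assms] ne by (simp add: exp_add)
  then obtain n :: int where "Ln (pathfinish p - z) =
      2 * pi * \<i> * winding_number p z + Ln (pathstart p - z) + (of_int (2 * n) * pi) * \<i>"
    unfolding exp_eq by auto
  hence "winding_number p z - (log_mod z (pathfinish p) - log_mod z (pathstart p)) = of_int (- n)"
    by (simp add: log_mod_def field_simps)
  thus ?thesis by (metis Ints_of_int)
qed

lemma continuous_Ints_constant:
  fixes f :: "complex \<Rightarrow> complex"
  assumes "connected S" "continuous_on S f" "\<And>x. x \<in> S \<Longrightarrow> f x \<in> \<int>" "x \<in> S" "y \<in> S"
  shows "f x = f y"
proof -
  have "f constant_on S"
  proof (rule continuous_discrete_range_constant[OF assms(1,2)])
    fix x assume "x \<in> S"
    have "1 \<le> norm (f y - f x)" if "y \<in> S" "f y \<noteq> f x" for y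
    proof -
      have "f y - f x \<in> \<int>" using assms(3) \<open>x \<in> S\<close> that by (intro Ints_diff)
      then obtain k where "f y - f x = of_int k" by (rule Ints_cases)
      moreover from this that have "k \<noteq> 0" by auto
      ultimately show ?thesis by simp
    qed
    thus "\<exists>e>0. \<forall>y. y \<in> S \<and> f y \<noteq> f x \<longrightarrow> e \<le> norm (f y - f x)"
      by (intro exI[of _ 1]) auto
  qed
  thus ?thesis using assms(4,5) unfolding constant_on_def by metis
qed

section \<open>Cyclic permutations of the relator\<close>

lemma relator_word_simps [simp]:
  "relator_word [] = []"
  "relator_word ((x, e, h) # L) = Gen x e # Coef h # relator_word L"
  "relator_word (L @ L') = relator_word L @ relator_word L'"
  by (auto simp: relator_word_def)

lemma relator_word_inject: "relator_word L = relator_word L' \<longleftrightarrow> L = L'"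
proof (induction L arbitrary: L')
  case Nil
  thus ?case by (cases L') auto
next
  case (Cons a L)
  obtain x e h where a: "a = (x, e, h)" by (cases a)
  show ?case
  proof (cases L')
    case (Cons b M)
    obtain y f k where "b = (y, f, k)" by (cases b)
    thus ?thesis using Cons.IH[of M] a \<open>L' = b # M\<close> by auto
  qed (simp add: a)
qed

text \<open>The formal inverse of a relator word begins with a coefficient. With this letter moved
  to the end, each generator is followed by the inverse of the coefficient that precedes it
  cyclically in \<open>L\<close>; \<open>rotate1\<close> supplies these coefficients, the last one
  coming from the last triple of \<open>L\<close>.\<close>

definition inv_relator :: "('h, 'm) monoid_scheme \<Rightarrow> ('x, 'h) relator \<Rightarrow> ('x, 'h) relator" where
  "inv_relator H L =
     map2 (\<lambda>(x, e, h) (x', e', h'). (x, - e, inv\<^bsub>H\<^esub> h')) (rev L) (rotate1 (rev L))"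

lemma length_inv_relator [simp]: "length (inv_relator H L) = length L"
  by (simp add: inv_relator_def)

lemma rotate1_word_inv:
  "rotate1 (word_inv H (relator_word L)) = relator_word (inv_relator H L)"
proof -
  \<comment> \<open>The inverse word with each coefficient grouped in front of its generator; the
    rotation by one letter regroups it.\<close>
  define C where "C = (\<lambda>M :: ('a, 'b) relator. concat (map (\<lambda>(x, e, h). [Coef (inv\<^bsub>H\<^esub> h), Gen x (- e)]) M))"
  have C: "C [] = []" "C ((x, e, h) # M) = Coef (inv\<^bsub>H\<^esub> h) # Gen x (- e) # C M" "C (M @ M') = C M @ C M'"
    for x e h M M' by (simp_all add: C_def)
  have "word_inv H (relator_word L) = C (rev L)"
  proof (induction L)
    case (Cons a L)
    thus ?case by (cases a) (simp add: word_inv_def C)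
  qed (simp add: word_inv_def C)
  \<comment> \<open>The first generator and the final coefficient are kept as parameters, which
    makes the induction on \<open>M\<close> go through.\<close>
  moreover have "Gen x (- e) # C M @ [Coef (inv\<^bsub>H\<^esub> (snd (snd b)))] =
      relator_word (map2 (\<lambda>(x, e, h) (x', e', h'). (x, - e, inv\<^bsub>H\<^esub> h')) ((x, e, h) # M) (M @ [b]))" for x e h M b
  proof (induction M arbitrary: x e h)
    case Nil
    thus ?case by (cases b) (simp add: C)
  next
    case (Cons a M)
    thus ?case by (cases a) (simp add: C)
  qed
  moreover have "rotate1 (C M) = relator_word (map2 (\<lambda>(x, e, h) (x', e', h'). (x, - e, inv\<^bsub>H\<^esub> h')) M (rotate1 M))" for M
  proof (cases M)
    case (Cons a M')
    obtain x e h where "a = (x, e, h)" by (cases a)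
    thus ?thesis using calculation(2)[of x e M' a h] Cons by (simp add: C)
  qed (simp add: C)
  ultimately show ?thesis by (simp add: inv_relator_def)
qed

lemma rotate_relator_word: "rotate (2 * j) (relator_word L) = relator_word (rotate j L)"
proof (induction j)
  case (Suc j)
  have "rotate1 (rotate1 (relator_word M)) = relator_word (rotate1 M)" for M :: "('a, 'b) relator"
    by (cases M) auto
  thus ?case using Suc by simp
qed simp

text \<open>Generators and coefficients alternate, so a rotation that begins with a generator has
  moved an even number of letters.\<close>

lemma rotate_relator_word_gen:
  assumes "L \<noteq> []" "is_gen (hd (rotate n (relator_word L)))"
  shows "rotate n (relator_word L) = relator_word (rotate (n div 2) L)"
proof (cases "even n")
  case True
  thus ?thesis using rotate_relator_word[of "n div 2" L] by simp
next
  case False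
  then obtain j where n: "n = Suc (2 * j)" by (metis oddE Suc_eq_plus1)
  have "rotate n (relator_word L) = rotate1 (relator_word (rotate j L))"
    by (simp add: n flip: rotate_relator_word)
  moreover obtain x e h M where "rotate j L = (x, e, h) # M"
    using assms(1) by (metis neq_Nil_conv rotate_is_Nil_conv surj_pair)
  ultimately show ?thesis using assms(2) by (simp add: is_gen_def)
qed

lemma rotate1_map2: "length xs = length ys \<Longrightarrow> rotate1 (map2 f xs ys) = map2 f (rotate1 xs) (rotate1 ys)"
  by (cases xs; cases ys) auto

text \<open>Reversal turns a left rotation into a right one, which the outer rotation
  undoes.\<close>

lemma rotate_inv_relator: "rotate j (inv_relator H (rotate j L)) = inv_relator H L"
proof (induction j arbitrary: L)
  case (Suc j)
  have "rotate1 (rev (rotate1 M)) = rev M" for M :: "('a, 'b) relator"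
    by (cases M) auto
  hence "rotate1 (inv_relator H (rotate1 M)) = inv_relator H M" for M :: "('a, 'b) relator"
    by (simp add: inv_relator_def rotate1_map2)
  thus ?case using Suc[of L] by (metis rotate1_rotate_swap rotate_Suc)
qed simp

lemma relator_cycles_cases:
  assumes "w \<in> relator_cycles H R" "R \<noteq> []"
  obtains k where "w = relator_word (rotate k R)"
  | k where "w = relator_word (inv_relator H (rotate k R))"
proof -
  obtain n where n: "w = rotate n (relator_word R) \<or> w = rotate n (word_inv H (relator_word R))"
    and g: "is_gen (hd w)" using assms(1) by (auto simp: relator_cycles_def)
  from n show thesis
  proof
    assume "w = rotate n (relator_word R)"
    thus thesis using rotate_relator_word_gen[OF assms(2)] g that(1) by metis
  next
    assume w: "w = rotate n (word_inv H (relator_word R))"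
    define V where "V = inv_relator H R"
    have "V \<noteq> []" using assms(2) by (metis V_def length_0_conv length_inv_relator)
    define N where "N = length (relator_word V)"
    have lenW: "length (word_inv H (relator_word R)) = N"
      using rotate1_word_inv[of H R] by (metis N_def V_def length_rotate1)
    have "N > 0" using \<open>V \<noteq> []\<close> by (cases V) (auto simp: N_def)
    \<comment> \<open>A full turn is added so that one step can be split off even for
      \<open>n = 0\<close>; this step turns the inverse word into the word of an
      \<open>inv_relator\<close>.\<close>
    have "w = rotate (n + N) (word_inv H (relator_word R))"
      using w lenW by (metis mod_add_self2 rotate_conv_mod)
    also have "\<dots> = rotate (n + N - 1) (rotate1 (word_inv H (relator_word R)))"
      using \<open>N > 0\<close> by (cases "n + N") (auto simp: rotate1_rotate_swap)
    finally have "w = rotate (n + N - 1) (relator_word V)" by (simp add: rotate1_word_inv V_def)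
    then obtain j where j: "w = relator_word (rotate j V)"
      using rotate_relator_word_gen[OF \<open>V \<noteq> []\<close>] g by metis
    define r where "r = length R"
    \<comment> \<open>The complement of \<open>j\<close> to a full turn.\<close>
    define k where "k = r - j mod r"
    have "r > 0" using assms(2) by (simp add: r_def)
    hence "(j + k) mod r = 0"
      unfolding k_def by (metis add.commute le_add_diff_inverse2 less_imp_le mod_add_left_eq mod_less_divisor mod_self)
    have "rotate j V = rotate j (rotate k (inv_relator H (rotate k R)))"
      by (simp add: rotate_inv_relator V_def)
    also have "\<dots> = rotate ((j + k) mod r) (inv_relator H (rotate k R))"
      by (metis length_inv_relator length_rotate r_def rotate_conv_mod rotate_rotate)
    also have "\<dots> = inv_relator H (rotate k R)" using \<open>(j + k) mod r = 0\<close> by simp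
    finally show thesis using j that(2) by simp
  qed
qed

section \<open>Prefix weights under rotation and inversion\<close>

definition weights :: "('x \<Rightarrow> int) \<Rightarrow> ('x, 'h) relator \<Rightarrow> int list" where
  "weights \<theta> L = map (\<lambda>(x, e, h). e * \<theta> x) L"

lemma weights_simps [simp]:
  "length (weights \<theta> L) = length L"
  "weights \<theta> (rotate k L) = rotate k (weights \<theta> L)"
  by (simp_all add: weights_def rotate_map)

lemma weights_inv_relator: "weights \<theta> (inv_relator H L) = map uminus (rev (weights \<theta> L))"
proof -
  have "weights \<theta> (map2 (\<lambda>(x, e, h) (x', e', h'). (x, - e, inv\<^bsub>H\<^esub> h')) M N) = map uminus (weights \<theta> M)"
    if "length M = length N" for M N :: "('a, 'b) relator"
    using that by (induction M N rule: list_induct2) (auto simp: weights_def)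
  thus ?thesis by (simp add: inv_relator_def weights_def rev_map)
qed

lemma prefix_weight_eq:
  assumes "j \<le> length R"
  shows "prefix_weight \<theta> (skeleton R) j = sum_list (take j (weights \<theta> R))"
proof -
  have "prefix_weight \<theta> (skeleton R) j = (\<Sum>i<j. snd (skeleton R ! i) * \<theta> (fst (skeleton R ! i)))"
    unfolding prefix_weight_def
    by (rule sum.reindex_bij_witness[of _ Suc "\<lambda>i. i - 1"]) auto
  also have "\<dots> = (\<Sum>i<j. take j (weights \<theta> R) ! i)"
    using assms by (intro sum.cong) (auto simp: skeleton_def weights_def case_prod_beta)
  also have "\<dots> = sum_list (take j (weights \<theta> R))"
    using assms by (simp add: sum_list_sum_nth atLeast0LessThan min_absorb2)
  finally show ?thesis .
qed

text \<open>Rotation by \<open>k\<close> moves the base point of the prefix sums to position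
  \<open>k\<close>. A position \<open>j\<close> before \<open>k\<close> is reached past the end of
  the list, at no cost since the total is 0.\<close>

lemma sum_list_take_rotate:
  fixes u :: "int list"
  assumes "sum_list u = 0" "k < length u" "j \<le> length u"
  obtains m where "m \<le> length u" "sum_list (take m (rotate k u)) = sum_list (take j u) - sum_list (take k u)"
proof -
  have rot: "rotate k u = drop k u @ take k u" using assms(2) by (simp add: rotate_drop_take)
  have tot: "sum_list (take k u) + sum_list (drop k u) = 0"
    using assms(1) by (metis append_take_drop_id sum_list_append)
  show thesis
  proof (cases "k \<le> j")
    case True
    have "take j u = take k u @ take (j - k) (drop k u)"
      using True by (metis le_add_diff_inverse take_add)
    thus thesis using that[of "j - k"] rot assms by simp
  next
    case False
    hence "take (length u - k + j) (rotate k u) = drop k u @ take j u"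
      using rot assms by (simp add: min_absorb1)
    thus thesis using that[of "length u - k + j"] tot False assms by simp
  qed
qed

text \<open>Nonnegative prefix sums after the rotation say that position \<open>k\<close> minimizes
  the prefix sums of \<open>R\<close>, and this minimum is attained only at
  \<open>l\<close>.\<close>

lemma rotate_eq_of_unique_min:
  fixes R :: "('x, 'h) relator"
  assumes adm: "admissible \<theta> (skeleton R)" and l: "l \<in> {1..length R}"
    and min: "\<And>j. j \<in> {1..length R} - {l} \<Longrightarrow>
        prefix_weight \<theta> (skeleton R) j > prefix_weight \<theta> (skeleton R) l"
    and nonneg: "\<And>m. m \<le> length R \<Longrightarrow> 0 \<le> sum_list (take m (weights \<theta> (rotate k R)))"
  shows "rotate k R = rotate l R"
proof -
  let ?u = "weights \<theta> R" and ?r = "length R"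
  have r: "?r > 0" using l by auto
  have tot: "sum_list ?u = 0"
    using adm prefix_weight_eq[of "length R" R \<theta>] by (simp add: admissible_def skeleton_def)
  define k' where "k' = k mod ?r"
  have k': "k' < ?r" using r by (simp add: k'_def)
  have rk: "rotate k R = rotate k' R" by (simp add: k'_def flip: rotate_conv_mod)
  obtain m where "m \<le> ?r" "sum_list (take m (rotate k' ?u)) = sum_list (take l ?u) - sum_list (take k' ?u)"
    using sum_list_take_rotate[OF tot, of k' l] k' l by auto
  hence le: "sum_list (take k' ?u) \<le> sum_list (take l ?u)"
    using nonneg[of m] by (simp add: rk)
  \<comment> \<open>Positions 0 and \<open>length R\<close> give the same rotation and the same
    prefix sum, but the unique min property speaks of positions from 1 on.\<close>
  define j where "j = (if k' = 0 then ?r else k')"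
  have j: "j \<in> {1..?r}" "rotate j R = rotate k' R" using k' r by (auto simp: j_def)
  have "sum_list (take j ?u) = sum_list (take k' ?u)" using tot by (simp add: j_def)
  hence "\<not> prefix_weight \<theta> (skeleton R) j > prefix_weight \<theta> (skeleton R) l"
    using le j l prefix_weight_eq[of j R \<theta>] prefix_weight_eq[of l R \<theta>] by simp
  hence "j = l" using min[of j] j by blast
  thus ?thesis using j rk by simp
qed

text \<open>The first \<open>m\<close> letters of the inverse undo the last \<open>m\<close> letters
  of \<open>u\<close>, so the inverse visits the prefix sums of \<open>u\<close> in reverse order. A
  base point is thus minimal for a relator exactly when it is for the inverse.\<close>

lemma sum_list_take_inv:
  fixes u :: "int list"
  assumes "sum_list u = 0" "m \<le> length u"
  shows "sum_list (take m (map uminus (rev u))) = sum_list (take (length u - m) u)"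
proof -
  have neg: "sum_list (map uminus v) = - sum_list v" for v :: "int list" by (induction v) auto
  have "sum_list (take m (map uminus (rev u))) = - sum_list (drop (length u - m) u)"
    by (simp add: take_map take_rev neg)
  moreover have "sum_list (take (length u - m) u) + sum_list (drop (length u - m) u) = 0"
    using assms(1) by (metis append_take_drop_id sum_list_append)
  ultimately show ?thesis by simp
qed

lemma sum_list_rotate: "sum_list (rotate k u) = sum_list (u :: int list)"
proof -
  have "sum_list (drop (k mod length u) u) + sum_list (take (k mod length u) u) = sum_list u"
    by (metis add.commute append_take_drop_id sum_list_append)
  thus ?thesis by (simp add: rotate_drop_take)
qed

lemma total_weight_zero:
  assumes "relator_word L \<in> relator_cycles H R" "R \<noteq> []" "admissible \<theta> (skeleton R)"
  shows "sum_list (weights \<theta> L) = 0"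
proof -
  have tot: "sum_list (weights \<theta> R) = 0"
    using assms(3) prefix_weight_eq[of "length R" R \<theta>] by (simp add: admissible_def skeleton_def)
  have neg: "sum_list (map uminus v) = - sum_list v" for v :: "int list" by (induction v) auto
  show ?thesis
  proof (rule relator_cycles_cases[OF assms(1,2)])
    fix k assume "relator_word L = relator_word (rotate k R)"
    thus ?thesis using tot by (simp add: relator_word_inject sum_list_rotate)
  next
    fix k assume "relator_word L = relator_word (inv_relator H (rotate k R))"
    thus ?thesis using tot by (simp add: relator_word_inject weights_inv_relator neg sum_list_rotate)
  qed
qed

text \<open>The last hypothesis makes the starting point of \<open>L\<close> a lowest one. Since
  inversion only reverses the order of the prefix sums, both kinds of cycles reduce to
  \<open>rotate_eq_of_unique_min\<close>.\<close>

lemma minimal_cycle_cases: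
  fixes R L :: "('x, 'h) relator"
  assumes L: "relator_word L \<in> relator_cycles H R"
    and adm: "admissible \<theta> (skeleton R)" and l: "l \<in> {1..length R}"
    and min: "\<And>j. j \<in> {1..length R} - {l} \<Longrightarrow>
        prefix_weight \<theta> (skeleton R) j > prefix_weight \<theta> (skeleton R) l"
    and nonneg: "\<And>m. m \<le> length L \<Longrightarrow> 0 \<le> sum_list (take m (weights \<theta> L))"
  shows "L = rotate l R \<or> L = inv_relator H (rotate l R)"
proof -
  have ne: "R \<noteq> []" using l by auto
  have tot: "sum_list (weights \<theta> R) = 0"
    using adm prefix_weight_eq[of "length R" R \<theta>] by (simp add: admissible_def skeleton_def)
  show ?thesis
  proof (rule relator_cycles_cases[OF L ne])
    fix k assume "relator_word L = relator_word (rotate k R)"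
    hence L: "L = rotate k R" by (simp add: relator_word_inject)
    have "rotate k R = rotate l R"
      by (rule rotate_eq_of_unique_min[OF adm l min]) (use nonneg L in auto)
    thus ?thesis using L by simp
  next
    fix k assume "relator_word L = relator_word (inv_relator H (rotate k R))"
    hence L: "L = inv_relator H (rotate k R)" by (simp add: relator_word_inject)
    have "0 \<le> sum_list (take m (weights \<theta> (rotate k R)))" if "m \<le> length R" for m
      using nonneg[of "length R - m"] that tot L
        sum_list_take_inv[of "weights \<theta> (rotate k R)" "length R - m"]
      by (simp add: weights_inv_relator sum_list_rotate)
    hence "rotate k R = rotate l R"
      by (intro rotate_eq_of_unique_min[OF adm l min]) auto
    thus ?thesis using L by simp
  qed
qed

text \<open>For the rotation of \<open>R\<close> by \<open>l\<close>, the head generator is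
  \<open>x_(l+1)\<close> and the last one is \<open>x_l\<close>; that inversion exchanges two
  different generators will decide how the second disc is read.\<close>

lemma hd_last_inv_relator:
  assumes "Q \<noteq> []"
  shows "fst (hd (inv_relator H Q)) = fst (last Q)" "fst (last (inv_relator H Q)) = fst (hd Q)"
proof -
  have ne: "inv_relator H Q \<noteq> []" using assms by (metis length_0_conv length_inv_relator)
  have nth: "fst (inv_relator H Q ! i) = fst (rev Q ! i)" if "i < length Q" for i
    using that by (simp add: inv_relator_def case_prod_beta)
  show "fst (hd (inv_relator H Q)) = fst (last Q)"
    using nth[of 0] ne assms by (simp add: hd_conv_nth flip: hd_rev)
  show "fst (last (inv_relator H Q)) = fst (hd Q)"
    using nth[of "length Q - 1"] ne assms by (simp add: last_conv_nth hd_conv_nth rev_nth)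
qed

text \<open>This is the form in which a dipole compares its two corner words.\<close>

lemma relator_word_split:
  assumes "Q \<noteq> []"
  obtains S h where "S \<noteq> []" "is_gen (hd S)" "is_gen (last S)" "relator_word Q = S @ [Coef h]"
    "relator_word (inv_relator H Q) = word_inv H S @ [Coef (inv\<^bsub>H\<^esub> h)]"
proof -
  obtain Q' x e h where Q: "Q = Q' @ [(x, e, h)]"
    using assms by (metis append_butlast_last_id surj_pair)
  define S where "S = relator_word Q' @ [Gen x e]"
  have eq: "relator_word Q = S @ [Coef h]" by (simp add: Q S_def)
  show thesis
  proof (rule that[OF _ _ _ eq])
    show "S \<noteq> []" "is_gen (last S)" by (auto simp: S_def is_gen_def)
    show "is_gen (hd S)" by (cases Q') (auto simp: S_def is_gen_def)
    show "relator_word (inv_relator H Q) = word_inv H S @ [Coef (inv\<^bsub>H\<^esub> h)]"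
      by (simp add: eq word_inv_def flip: rotate1_word_inv)
  qed
qed

section \<open>The potential of a picture\<close>

definition crossing :: "('x, 'h, 'a) labelled_picture_scheme \<Rightarrow> complex \<Rightarrow> 'x \<times> int" where
  "crossing P p =
     (let A = (THE A. A \<in> arcs P \<and> p \<in> A)
      in if p = pathstart (along P A) then arc_label P A
         else (fst (arc_label P A), - snd (arc_label P A)))"

lemma crossing_letter_eq:
  "crossing_letter P p = Gen (fst (crossing P p)) (snd (crossing P p))"
  by (simp add: crossing_letter_def crossing_def Let_def split: prod.split)

definition arc_ends :: "'a picture_scheme \<Rightarrow> complex set" where
  "arc_ends P = arc_union P \<inter> \<Union> (frontier ` discs P)"

text \<open>The part of \<open>corner_word\<close> that concerns the loop alone. The corner whose
  word is read is the piece from \<open>last ts\<close> to 1.\<close>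

definition corner_loop ::
    "'a picture_scheme \<Rightarrow> complex set \<Rightarrow> (real \<Rightarrow> complex) \<Rightarrow> real list \<Rightarrow> bool" where
  "corner_loop P \<Delta> c ts \<longleftrightarrow>
     clockwise_boundary \<Delta> c \<and> ts \<noteq> [] \<and> sorted_wrt (<) ts \<and>
     set ts = {t \<in> {0..<1}. c t \<in> arc_union P} \<and> hd ts = 0"

definition loop_relator ::
    "('x, 'h, 'a) labelled_picture_scheme \<Rightarrow> (real \<Rightarrow> complex) \<Rightarrow> real list \<Rightarrow> ('x, 'h) relator" where
  "loop_relator P c ts =
     map2 (\<lambda>s t. (fst (crossing P (c s)), snd (crossing P (c s)), corner_label P (c ` {s..t})))
       ts (tl ts @ [1])"

lemma corner_word_iff:
  "corner_word P \<kappa> w \<longleftrightarrow>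
     (\<exists>\<Delta> \<in> discs P. \<exists>c ts. corner_loop P \<Delta> c ts \<and> \<kappa> = c ` {last ts..1} \<and>
        w = relator_word (loop_relator P c ts))"
proof -
  have "concat (map2 (\<lambda>s t. [crossing_letter P (c s), Coef (corner_label P (c ` {s..t}))]) xs ys) =
      relator_word (map2 (\<lambda>s t. (fst (crossing P (c s)), snd (crossing P (c s)),
        corner_label P (c ` {s..t}))) xs ys)" for c and xs ys :: "real list"
    by (induction xs ys rule: list_induct2') (simp_all add: crossing_letter_eq)
  thus ?thesis unfolding corner_word_def corner_loop_def loop_relator_def by (simp only: conj_assoc)
qed

lemma length_loop_relator: "ts \<noteq> [] \<Longrightarrow> length (loop_relator P c ts) = length ts"
  by (simp add: loop_relator_def)

lemma fst_loop_relator_nth: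
  "i < length ts \<Longrightarrow> fst (loop_relator P c ts ! i) = fst (crossing P (c (ts ! i)))"
  by (simp add: loop_relator_def)

definition crossing_weight ::
    "('x \<Rightarrow> int) \<Rightarrow> ('x, 'h, 'a) labelled_picture_scheme \<Rightarrow> complex \<Rightarrow> int" where
  "crossing_weight \<theta> P p = snd (crossing P p) * \<theta> (fst (crossing P p))"

lemma weights_loop_relator:
  assumes "ts \<noteq> []"
  shows "weights \<theta> (loop_relator P c ts) = map (\<lambda>t. crossing_weight \<theta> P (c t)) ts"
  by (rule nth_equalityI)
    (use assms in \<open>auto simp: weights_def loop_relator_def crossing_weight_def\<close>)

text \<open>The default 1 closes the last interval at the base point of the loop.\<close>

definition next_time :: "real list \<Rightarrow> nat \<Rightarrow> real" where
  "next_time ts i = (if Suc i < length ts then ts ! Suc i else 1)"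

locale weighted_picture =
  fixes X :: "'x set" and H :: "('h, 'm) monoid_scheme" and R :: "('x, 'h) relator"
    and P :: "('x, 'h) labelled_picture" and \<theta> :: "'x \<Rightarrow> int"
  assumes over: "picture_over X H R P" and sph: "spherical P"
    and nonempty: "R \<noteq> []" and adm: "admissible \<theta> (skeleton R)"
begin

abbreviation om :: "complex \<Rightarrow> int" where "om \<equiv> crossing_weight \<theta> P"

lemma pic: "is_picture P"
  using over by (simp add: picture_over_def)

lemma finite_discs: "finite (discs P)" and finite_arcs: "finite (arcs P)"
  using pic by (auto simp: is_picture_def)

lemma disc_hom: "\<Delta> \<in> discs P \<Longrightarrow> \<Delta> homeomorphic (cball 0 1 :: complex set)"
  and disc_ball: "\<Delta> \<in> discs P \<Longrightarrow> \<Delta> \<subseteq> ball 0 1"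
  using pic by (auto simp: is_picture_def)

lemma disc_eq: "\<Delta> \<in> discs P \<Longrightarrow> \<Delta>' \<in> discs P \<Longrightarrow> p \<in> \<Delta> \<Longrightarrow> p \<in> \<Delta>' \<Longrightarrow> \<Delta> = \<Delta>'"
  using pic pairwiseD[of disjnt "discs P" \<Delta> \<Delta>'] by (auto simp: is_picture_def disjnt_iff)

lemma arc_eq: "A \<in> arcs P \<Longrightarrow> B \<in> arcs P \<Longrightarrow> p \<in> A \<Longrightarrow> p \<in> B \<Longrightarrow> A = B"
  using pic pairwiseD[of disjnt "arcs P" A B] by (auto simp: is_picture_def disjnt_iff)

lemma disc_compact: "\<Delta> \<in> discs P \<Longrightarrow> compact \<Delta>"
  using disc_hom homeomorphic_cball_compact by blast

lemma disc_closed: "\<Delta> \<in> discs P \<Longrightarrow> closed \<Delta>"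
  using disc_compact compact_imp_closed by blast

lemma frontier_disc: "\<Delta> \<in> discs P \<Longrightarrow> frontier \<Delta> \<subseteq> \<Delta>"
  using disc_closed frontier_subset_eq by blast

lemma path_image_along: "A \<in> arcs P \<Longrightarrow> path_image (along P A) = A"
  using over by (auto simp: picture_over_def)

text \<open>As the picture is spherical, a proper arc has both ends on discs. It cannot enter the
  interior of a disc, which is open and misses the complement of the discs, hence also its
  closure.\<close>

lemma along_cases:
  assumes "A \<in> arcs P"
  obtains (closed_curve) "path (along P A)" "pathfinish (along P A) = pathstart (along P A)"
      "A \<inter> disc_union P = {}"
  | (proper) "arc (along P A)" "A \<inter> disc_union P = {pathstart (along P A), pathfinish (along P A)}"
      "pathstart (along P A) \<in> arc_ends P" "pathfinish (along P A) \<in> arc_ends P"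
proof -
  let ?g = "along P A"
  have im: "path_image ?g = A" by (rule path_image_along[OF assms])
  have "closed_curve_param P ?g \<or> proper_arc_param P ?g"
    using over assms by (auto simp: picture_over_def)
  thus thesis
  proof
    assume "closed_curve_param P ?g"
    thus thesis using closed_curve im by (auto simp: closed_curve_param_def simple_path_imp_path)
  next
    assume pr: "proper_arc_param P ?g"
    hence a: "arc ?g" and cl: "A \<subseteq> closure (cball 0 1 - disc_union P)"
      and ends: "A \<inter> (sphere 0 1 \<union> \<Union> (frontier ` discs P)) = {pathstart ?g, pathfinish ?g}"
      using im by (auto simp: proper_arc_param_def)
    have ns: "A \<inter> sphere 0 1 = {}" using sph assms by (auto simp: spherical_def)
    hence ends': "A \<inter> \<Union> (frontier ` discs P) = {pathstart ?g, pathfinish ?g}" using ends by blast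
    have "interior \<Delta> \<inter> A = {}" if "\<Delta> \<in> discs P" for \<Delta>
    proof -
      have "interior \<Delta> \<inter> (cball 0 1 - disc_union P) = {}" using interior_subset that by blast
      hence "interior \<Delta> \<inter> closure (cball 0 1 - disc_union P) = {}"
        by (simp add: open_Int_closure_eq_empty)
      thus ?thesis using cl by blast
    qed
    moreover have "\<Delta> = interior \<Delta> \<union> frontier \<Delta>" if "\<Delta> \<in> discs P" for \<Delta>
      using disc_closed[OF that] interior_subset[of \<Delta>] by (auto simp: frontier_def)
    ultimately have "A \<inter> disc_union P = A \<inter> \<Union> (frontier ` discs P)"
      using frontier_disc by blast
    hence "A \<inter> disc_union P = {pathstart ?g, pathfinish ?g}" using ends' by simp
    moreover have "pathstart ?g \<in> arc_ends P" "pathfinish ?g \<in> arc_ends P"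
      using ends' assms by (auto simp: arc_ends_def)
    ultimately show thesis using proper[OF a] by blast
  qed
qed

lemma path_along: "A \<in> arcs P \<Longrightarrow> path (along P A)"
  by (erule along_cases) (auto simp: arc_imp_path)

lemma arc_compact: "A \<in> arcs P \<Longrightarrow> compact A"
  using path_along path_image_along compact_path_image by metis

lemma arc_ends_disc: "p \<in> arc_ends P \<Longrightarrow> p \<in> disc_union P"
  using frontier_disc by (auto simp: arc_ends_def)

lemma the_arc: "A \<in> arcs P \<Longrightarrow> p \<in> A \<Longrightarrow> (THE A. A \<in> arcs P \<and> p \<in> A) = A"
  using arc_eq by (intro the_equality) blast+

lemma crossing_start: "A \<in> arcs P \<Longrightarrow> crossing P (pathstart (along P A)) = arc_label P A"
  using the_arc[of A "pathstart (along P A)"] path_image_along pathstart_in_path_image[of "along P A"]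
  by (simp add: crossing_def)

lemma crossing_finish:
  assumes "A \<in> arcs P" "arc (along P A)"
  shows "crossing P (pathfinish (along P A)) = (fst (arc_label P A), - snd (arc_label P A))"
  using the_arc[of A "pathfinish (along P A)"] path_image_along pathfinish_in_path_image[of "along P A"]
    arc_distinct_ends[OF assms(2)] assms(1)
  by (auto simp: crossing_def Let_def)

text \<open>The arc is parametrized from the given end, reversed if necessary. Going clockwise
  around the discs, its two ends are crossed in opposite directions with respect to the normal
  orientation.\<close>

lemma arc_at_end:
  assumes "p \<in> arc_ends P"
  obtains A \<gamma> where "A \<in> arcs P" "arc \<gamma>" "path_image \<gamma> = A" "\<gamma> 0 = p" "A \<inter> disc_union P = {p, \<gamma> 1}"
    "\<gamma> 1 \<in> arc_ends P" "crossing P (\<gamma> 1) = (fst (crossing P p), - snd (crossing P p))"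
    "crossing P p \<in> X \<times> {1, -1}"
proof -
  obtain A where A: "A \<in> arcs P" "p \<in> A" using assms by (auto simp: arc_ends_def)
  have pd: "p \<in> A \<inter> disc_union P" using A arc_ends_disc[OF assms] by blast
  have lab: "arc_label P A \<in> X \<times> {1, -1}" using over A by (auto simp: picture_over_def)
  from A(1) show thesis
  proof (cases rule: along_cases)
    case closed_curve
    thus thesis using pd by blast
  next
    case proper
    hence "p = pathstart (along P A) \<or> p = pathfinish (along P A)" using pd by blast
    thus thesis
    proof
      assume p: "p = pathstart (along P A)"
      show thesis
        by (rule that[of A "along P A"])
          (use A proper p lab crossing_start[OF A(1)] crossing_finish[OF A(1)] path_image_along[OF A(1)]
            in \<open>auto simp: pathstart_def pathfinish_def\<close>)
    next
      assume p: "p = pathfinish (along P A)"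
      have c: "crossing P p = (fst (arc_label P A), - snd (arc_label P A))"
        using crossing_finish A proper p by simp
      show thesis
        by (rule that[of A "reversepath (along P A)"])
          (use A proper p lab crossing_start[OF A(1)] c path_image_along[OF A(1)]
            in \<open>auto simp: reversepath_def pathstart_def pathfinish_def arc_reversepath[unfolded reversepath_def] path_image_reversepath[unfolded reversepath_def]\<close>)
    qed
  qed
qed

lemma arc_Int_ends:
  assumes "A \<in> arcs P"
  shows "finite (A \<inter> arc_ends P)"
  using assms
proof (cases rule: along_cases)
  case closed_curve
  hence "A \<inter> arc_ends P = {}" using arc_ends_disc by blast
  thus ?thesis by simp
next
  case proper
  have "A \<inter> arc_ends P \<subseteq> {pathstart (along P A), pathfinish (along P A)}"
    using proper arc_ends_disc by blast
  thus ?thesis using finite_subset by blast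
qed

lemma arc_ends_Union: "arc_ends P = (\<Union>A\<in>arcs P. A \<inter> arc_ends P)"
  by (auto simp: arc_ends_def)

lemma finite_ends: "finite (arc_ends P)"
  by (subst arc_ends_Union, rule finite_UN_I) (auto intro: finite_arcs arc_Int_ends)

lemma frontier_not_arc_nonempty:
  assumes "\<Delta> \<in> discs P"
  obtains z where "z \<in> frontier \<Delta> - arc_union P"
proof -
  have "frontier \<Delta> \<inter> arc_union P \<subseteq> arc_ends P" using assms by (auto simp: arc_ends_def)
  hence "infinite (frontier \<Delta> - arc_union P)"
    using infinite_frontier_disc[OF disc_hom[OF assms]] finite_ends
    by (metis Diff_Int2 Diff_infinite_finite Int_absorb Diff_Int_distrib finite_subset Diff_Int Un_empty_left Diff_cancel)
  thus thesis using that by (metis ex_in_conv finite.emptyI)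
qed

lemma corner_loopD:
  assumes "corner_loop P \<Delta> c ts"
  shows "simple_path c" "c 1 = c 0" "c ` {0..1} = frontier \<Delta>" "ts \<noteq> []" "ts ! 0 = 0"
    and "\<And>i. i < length ts \<Longrightarrow> 0 \<le> ts ! i \<and> ts ! i < 1 \<and> c (ts ! i) \<in> arc_union P"
    and "\<And>t. 0 \<le> t \<Longrightarrow> t < 1 \<Longrightarrow> c t \<in> arc_union P \<Longrightarrow> t \<in> set ts"
proof -
  have l: "clockwise_boundary \<Delta> c" "ts \<noteq> []" "sorted_wrt (<) ts"
    "set ts = {t \<in> {0..<1}. c t \<in> arc_union P}" "hd ts = 0"
    using assms by (auto simp: corner_loop_def)
  show "simple_path c" "c 1 = c 0" "c ` {0..1} = frontier \<Delta>"
    using l(1) by (auto simp: clockwise_boundary_def pathstart_def pathfinish_def path_image_def)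
  show "ts \<noteq> []" "ts ! 0 = 0" using l by (auto simp: hd_conv_nth)
  show "0 \<le> ts ! i \<and> ts ! i < 1 \<and> c (ts ! i) \<in> arc_union P" if "i < length ts" for i
    using l(4) nth_mem[OF that] by auto
  show "t \<in> set ts" if "0 \<le> t" "t < 1" "c t \<in> arc_union P" for t
    using l(4) that by auto
qed

text \<open>\<open>corner_word\<close> leaves the disc existential; the point \<open>z\<close> of
  the corner lies on both discs and identifies them.\<close>

lemma exists_corner_loop:
  assumes D: "\<Delta> \<in> discs P" and z: "z \<in> frontier \<Delta> - arc_union P"
  defines "C \<equiv> connected_component_set (frontier \<Delta> - arc_union P) z"
  obtains c ts where "corner_loop P \<Delta> c ts" "closure C = c ` {last ts..1}"
    "relator_word (loop_relator P c ts) \<in> relator_cycles H R" "closure C \<in> corners P"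
proof -
  have "C \<in> components (frontier \<Delta> - arc_union P)" unfolding C_def using z by (rule componentsI)
  hence k: "closure C \<in> corners P" using D by (auto simp: corners_def)
  then obtain w where w: "w \<in> relator_cycles H R" "corner_word P (closure C) w"
    using over by (auto simp: picture_over_def)
  obtain \<Delta>' c ts where l: "\<Delta>' \<in> discs P" "corner_loop P \<Delta>' c ts" "closure C = c ` {last ts..1}"
    "w = relator_word (loop_relator P c ts)"
    using w(2) unfolding corner_word_iff by blast
  have "z \<in> C" using z by (simp add: C_def)
  have "last ts \<in> set ts" using corner_loopD(4)[OF l(2)] by simp
  hence "last ts \<ge> 0" using corner_loopD(6)[OF l(2)] by (metis in_set_conv_nth)
  have "z \<in> c ` {last ts..1}" using \<open>z \<in> C\<close> l(3) closure_subset by blast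
  also have "\<dots> \<subseteq> path_image c" using \<open>last ts \<ge> 0\<close> by (auto simp: path_image_def)
  also have "\<dots> = frontier \<Delta>'" using l(2) by (simp add: corner_loop_def clockwise_boundary_def)
  finally have "z \<in> \<Delta>'" using frontier_disc l(1) by blast
  moreover have "z \<in> \<Delta>" using z frontier_disc D by blast
  ultimately have "\<Delta>' = \<Delta>" using disc_eq D l(1) by blast
  thus thesis using that l w k by simp
qed

text \<open>Around the boundary the weights are those of a cyclic permutation of the relator or its
  inverse, with total 0 by admissibility. This is what closes the weighted cycle at the hub.\<close>

lemma disc_weight_zero:
  assumes D: "\<Delta> \<in> discs P"
  shows "(\<Sum>p\<in>arc_ends P \<inter> \<Delta>. om p) = 0"
proof -
  obtain z where z: "z \<in> frontier \<Delta> - arc_union P" using frontier_not_arc_nonempty[OF D] .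
  obtain c ts where l: "corner_loop P \<Delta> c ts"
    "relator_word (loop_relator P c ts) \<in> relator_cycles H R"
    using exists_corner_loop[OF D z] by metis
  note l' = corner_loopD[OF l(1)]
  have sts: "set ts = {t \<in> {0..<1}. c t \<in> arc_union P}" "distinct ts"
    using l(1) strict_sorted_iff by (auto simp: corner_loop_def)
  have inj: "inj_on c (set ts)"
  proof (rule inj_onI)
    fix s t assume "s \<in> set ts" "t \<in> set ts" "c s = c t"
    thus "s = t" using l'(1) sts(1) unfolding simple_path_def loop_free_def by fastforce
  qed
  have "arc_ends P \<inter> \<Delta> = c ` set ts"
  proof
    show "arc_ends P \<inter> \<Delta> \<subseteq> c ` set ts"
    proof
      fix p assume p: "p \<in> arc_ends P \<inter> \<Delta>"
      then obtain \<Delta>' where "\<Delta>' \<in> discs P" "p \<in> frontier \<Delta>'" by (auto simp: arc_ends_def)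
      hence "p \<in> frontier \<Delta>" using disc_eq[OF D, of \<Delta>' p] p frontier_disc by blast
      then obtain t where t: "t \<in> {0..1}" "p = c t" using l'(3) by blast
      define t0 where "t0 = (if t = 1 then 0 else t)"
      have "0 \<le> t0" "t0 < 1" "p = c t0" using t l'(2) by (auto simp: t0_def)
      moreover have "p \<in> arc_union P" using p by (simp add: arc_ends_def)
      ultimately show "p \<in> c ` set ts" using l'(7)[of t0] by blast
    qed
    show "c ` set ts \<subseteq> arc_ends P \<inter> \<Delta>"
    proof
      fix p assume "p \<in> c ` set ts"
      then obtain t where t: "t \<in> {0..<1}" "p = c t" "c t \<in> arc_union P" using sts(1) by auto
      hence "p \<in> frontier \<Delta>" using l'(3) by force
      thus "p \<in> arc_ends P \<inter> \<Delta>" using t D frontier_disc by (auto simp: arc_ends_def)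
    qed
  qed
  hence "(\<Sum>p\<in>arc_ends P \<inter> \<Delta>. om p) = (\<Sum>t\<in>set ts. om (c t))"
    using inj by (simp add: sum.reindex)
  also have "\<dots> = sum_list (map (\<lambda>t. om (c t)) ts)"
    using sts(2) by (simp add: sum_list_distinct_conv_sum_set)
  also have "\<dots> = sum_list (weights \<theta> (loop_relator P c ts))"
    using l'(4) by (simp add: weights_loop_relator)
  also have "\<dots> = 0" using total_weight_zero[OF l(2) nonempty adm] .
  finally show ?thesis .
qed

section \<open>Hubs, spokes and the potential\<close>

definition disc_at :: "complex \<Rightarrow> complex set" where
  "disc_at p = (THE \<Delta>. \<Delta> \<in> discs P \<and> p \<in> \<Delta>)"

definition hub :: "complex set \<Rightarrow> complex" where
  "hub \<Delta> = (SOME m. \<exists>ray. disc_rays \<Delta> m ray)"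

definition rays :: "complex set \<Rightarrow> complex \<Rightarrow> real \<Rightarrow> complex" where
  "rays \<Delta> = (SOME ray. disc_rays \<Delta> (hub \<Delta>) ray)"

definition spoke :: "complex \<Rightarrow> real \<Rightarrow> complex" where
  "spoke p = rays (disc_at p) p"

lemma disc_at: "\<Delta> \<in> discs P \<Longrightarrow> p \<in> \<Delta> \<Longrightarrow> disc_at p = \<Delta>"
  unfolding disc_at_def by (rule the_equality) (simp, metis disc_eq)

lemma disc_rays: "\<Delta> \<in> discs P \<Longrightarrow> disc_rays \<Delta> (hub \<Delta>) (rays \<Delta>)"
proof -
  assume "\<Delta> \<in> discs P"
  hence "\<exists>m ray. disc_rays \<Delta> m ray" using exists_disc_rays disc_hom by metis
  hence "\<exists>ray. disc_rays \<Delta> (hub \<Delta>) ray" unfolding hub_def by (rule someI_ex)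
  thus ?thesis unfolding rays_def by (rule someI_ex)
qed

lemma spoke:
  assumes "p \<in> arc_ends P"
  shows "path (spoke p)" "pathstart (spoke p) = hub (disc_at p)" "pathfinish (spoke p) = p"
    "path_image (spoke p) \<subseteq> insert p (interior (disc_at p))"
    "disc_at p \<in> discs P" "p \<in> frontier (disc_at p)"
proof -
  obtain \<Delta> where D: "\<Delta> \<in> discs P" "p \<in> frontier \<Delta>" using assms by (auto simp: arc_ends_def)
  hence "disc_at p = \<Delta>" using disc_at frontier_disc by blast
  thus "path (spoke p)" "pathstart (spoke p) = hub (disc_at p)" "pathfinish (spoke p) = p"
    "path_image (spoke p) \<subseteq> insert p (interior (disc_at p))" "disc_at p \<in> discs P" "p \<in> frontier (disc_at p)"
    using disc_raysD[OF disc_rays[OF D(1)] D(2)] D by (simp_all add: spoke_def)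
qed

definition arc_weight :: "complex set \<Rightarrow> int" where
  "arc_weight A = snd (arc_label P A) * \<theta> (fst (arc_label P A))"

text \<open>The parameter \<open>W\<close> gives the contribution of each spoke, so that a spoke can
  later be exchanged for another path. Spokes run outwards, weighted by the letter at their outer
  end. That weight is \<open>arc_weight\<close> where the arc starts and its negative where it ends,
  so the cycle runs out along one spoke, along the arc and back along the other spoke.\<close>

definition cycle_winding :: "(complex \<Rightarrow> complex) \<Rightarrow> complex \<Rightarrow> complex" where
  "cycle_winding W z = (\<Sum>A\<in>arcs P. of_int (arc_weight A) * winding_number (along P A) z) +
     (\<Sum>p\<in>arc_ends P. of_int (om p) * W p)"

text \<open>A proper arc has opposite weights at its two ends. A closed curve has no ends on discs,
  and its term on the right vanishes because it starts where it finishes.\<close>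

lemma sum_ends_by_arcs:
  "(\<Sum>p\<in>arc_ends P. of_int (om p) * g p) =
   (\<Sum>A\<in>arcs P. of_int (arc_weight A) * (g (pathstart (along P A)) - g (pathfinish (along P A))))"
  for g :: "complex \<Rightarrow> complex"
proof -
  have "(\<Sum>p\<in>arc_ends P. of_int (om p) * g p) = (\<Sum>A\<in>arcs P. \<Sum>p\<in>A \<inter> arc_ends P. of_int (om p) * g p)"
    by (subst arc_ends_Union, rule sum.UNION_disjoint)
      (use finite_arcs arc_Int_ends arc_eq in blast)+
  also have "\<dots> = (\<Sum>A\<in>arcs P. of_int (arc_weight A) * (g (pathstart (along P A)) - g (pathfinish (along P A))))"
  proof (rule sum.cong[OF refl])
    fix A assume A: "A \<in> arcs P"
    thus "(\<Sum>p\<in>A \<inter> arc_ends P. of_int (om p) * g p) =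
        of_int (arc_weight A) * (g (pathstart (along P A)) - g (pathfinish (along P A)))"
    proof (cases rule: along_cases)
      case closed_curve
      hence "A \<inter> arc_ends P = {}" using arc_ends_disc by blast
      thus ?thesis using closed_curve by simp
    next
      case proper
      have e: "A \<inter> arc_ends P = {pathstart (along P A), pathfinish (along P A)}"
        using proper arc_ends_disc by blast
      show ?thesis
        unfolding e using arc_distinct_ends[OF proper(1)] crossing_start[OF A] crossing_finish[OF A proper(1)]
        by (simp add: crossing_weight_def arc_weight_def algebra_simps)
    qed
  qed
  finally show ?thesis .
qed

text \<open>All ends on one disc share its hub, so the vanishing total weight of the disc factors
  out.\<close>

lemma sum_ends_hub: "(\<Sum>p\<in>arc_ends P. of_int (om p) * g (hub (disc_at p))) = 0"
  for g :: "complex \<Rightarrow> complex"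
proof -
  have "arc_ends P = (\<Union>\<Delta>\<in>discs P. arc_ends P \<inter> \<Delta>)" using arc_ends_disc by blast
  hence "(\<Sum>p\<in>arc_ends P. of_int (om p) * g (hub (disc_at p))) =
      (\<Sum>p\<in>(\<Union>\<Delta>\<in>discs P. arc_ends P \<inter> \<Delta>). of_int (om p) * g (hub (disc_at p)))" by simp
  also have "\<dots> = (\<Sum>\<Delta>\<in>discs P. \<Sum>p\<in>arc_ends P \<inter> \<Delta>. of_int (om p) * g (hub (disc_at p)))"
    by (rule sum.UNION_disjoint) (use finite_discs finite_ends disc_eq in blast)+
  also have "\<dots> = (\<Sum>\<Delta>\<in>discs P. of_int (\<Sum>p\<in>arc_ends P \<inter> \<Delta>. om p) * g (hub \<Delta>))"
    by (intro sum.cong refl) (auto simp: disc_at sum_distrib_right intro!: sum.cong)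
  also have "\<dots> = 0" by (simp add: disc_weight_zero)
  finally show ?thesis .
qed

text \<open>The arcs together with the spokes, weighted by \<open>\<theta>\<close>, form a cycle: the weights cancel at
  the ends of the arcs, and at each hub because \<open>\<theta>\<close> is admissible. Hence the total winding number
  is an integer although the single paths are not closed.\<close>
lemma cycle_winding_Ints:
  assumes z: "\<And>A. A \<in> arcs P \<Longrightarrow> z \<notin> A"
    and W: "\<And>p. p \<in> arc_ends P \<Longrightarrow> W p - (log_mod z p - log_mod z (hub (disc_at p))) \<in> \<int>"
  shows "cycle_winding W z \<in> \<int>"
proof -
  let ?g = "log_mod z"
  let ?d = "\<lambda>A. winding_number (along P A) z - (?g (pathfinish (along P A)) - ?g (pathstart (along P A)))"
  let ?e = "\<lambda>p. W p - (?g p - ?g (hub (disc_at p)))"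
  have "cycle_winding W z = (\<Sum>A\<in>arcs P. of_int (arc_weight A) * ?d A) + (\<Sum>p\<in>arc_ends P. of_int (om p) * ?e p)"
    using sum_ends_by_arcs[of ?g] sum_ends_hub[of ?g]
    unfolding cycle_winding_def by (simp add: algebra_simps sum.distrib sum_subtractf)
  moreover have "?d A \<in> \<int>" if "A \<in> arcs P" for A
    using winding_number_log_mod[of "along P A" z] path_along path_image_along z that by simp
  ultimately show ?thesis using W by (auto intro!: Ints_add Ints_sum Ints_mult)
qed

text \<open>The sign: passing an outward spoke clockwise leads from its left to its right and lowers
  the winding number, while the potential is to rise by the weight read there.\<close>

definition potential :: "complex \<Rightarrow> complex" where
  "potential z = - cycle_winding (\<lambda>p. winding_number (spoke p) z) z"

lemma cycle_winding_continuous: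
  assumes "\<And>A. A \<in> arcs P \<Longrightarrow> S \<inter> A = {}"
    and "\<And>p. p \<in> arc_ends P \<Longrightarrow> continuous_on S (\<lambda>z. W z p)"
  shows "continuous_on S (\<lambda>z. cycle_winding (W z) z)"
  unfolding cycle_winding_def
proof (intro continuous_intros assms)
  fix A assume A: "A \<in> arcs P"
  show "continuous_on S (winding_number (along P A))"
    by (rule continuous_on_subset[OF continuous_on_winding_number])
      (use A path_along path_image_along assms(1) in \<open>auto\<close>)
qed

text \<open>Off the arcs and spokes the potential is continuous, and integral by
  \<open>cycle_winding_Ints\<close>.\<close>

lemma potential_constant:
  assumes S: "connected S" "x \<in> S" "y \<in> S"
    and "S \<inter> arc_union P = {}" "\<And>p. p \<in> arc_ends P \<Longrightarrow> S \<inter> path_image (spoke p) = {}"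
  shows "potential x = potential y"
proof (rule continuous_Ints_constant[OF S(1) _ _ S(2,3)])
  show "continuous_on S potential"
    unfolding potential_def
  proof (intro continuous_on_minus cycle_winding_continuous)
    fix p assume "p \<in> arc_ends P"
    thus "continuous_on S (\<lambda>z. winding_number (spoke p) z)"
      using spoke(1) assms(5) by (intro continuous_on_subset[OF continuous_on_winding_number]) auto
  qed (use assms in blast)
  fix z assume "z \<in> S"
  hence "winding_number (spoke p) z - (log_mod z p - log_mod z (hub (disc_at p))) \<in> \<int>"
    if "p \<in> arc_ends P" for p
    using winding_number_log_mod[of "spoke p" z] spoke[OF that] assms(5)[OF that] by auto
  thus "potential z \<in> \<int>"
    unfolding potential_def using \<open>z \<in> S\<close> assms(4) by (intro Ints_minus cycle_winding_Ints) blast+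
qed

lemma spoke_avoids:
  assumes D: "\<Delta> \<in> discs P" and x: "x \<in> frontier \<Delta>" "x \<noteq> p" and p: "p \<in> arc_ends P"
    and t: "0 < t" "t \<le> 1"
  shows "rays \<Delta> x t \<notin> path_image (spoke p)"
proof (cases "disc_at p = \<Delta>")
  case True
  have "p \<in> frontier \<Delta>" using spoke(6)[OF p] True by simp
  thus ?thesis unfolding spoke_def True by (rule disc_rays_notin[OF disc_rays[OF D] x(1) _ x(2) t])
next
  case False
  have "rays \<Delta> x t \<in> path_image (rays \<Delta> x)" using t by (simp add: path_image_def)
  also have "\<dots> \<subseteq> insert x (interior \<Delta>)" by (rule disc_raysD(4)[OF disc_rays[OF D] x(1)])
  also have "\<dots> \<subseteq> \<Delta>" using x(1) interior_subset[of \<Delta>] frontier_disc[OF D] by blast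
  finally have "rays \<Delta> x t \<in> \<Delta>" .
  moreover have "insert p (interior (disc_at p)) \<subseteq> disc_at p"
    using spoke(6)[OF p] interior_subset[of "disc_at p"] frontier_disc[OF spoke(5)[OF p]] by blast
  hence "path_image (spoke p) \<subseteq> disc_at p" using spoke(4)[OF p] by (rule order_trans[rotated])
  ultimately show ?thesis using disc_eq[OF D spoke(5)[OF p]] False by blast
qed

lemma interior_not_arc:
  assumes "\<Delta> \<in> discs P" "x \<in> interior \<Delta>"
  shows "x \<notin> arc_union P"
proof
  assume "x \<in> arc_union P"
  then obtain A where A: "A \<in> arcs P" "x \<in> A" by blast
  have xD: "x \<in> \<Delta>" using assms interior_subset by blast
  from A(1) show False
  proof (cases rule: along_cases)
    case closed_curve
    thus False using A xD assms by blast
  next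
    case proper
    have "x = pathstart (along P A) \<or> x = pathfinish (along P A)"
      using proper(2) A xD assms(1) by blast
    hence "x \<in> arc_ends P" using proper(3,4) by metis
    hence "x \<in> frontier \<Delta>" using spoke(5,6)[of x] disc_at[OF assms(1) xD] by simp
    thus False using assms by (simp add: frontier_def)
  qed
qed

lemma frontier_point_off_spokes:
  assumes "\<Delta> \<in> discs P" "x \<in> frontier \<Delta>" "x \<notin> arc_union P" "p \<in> arc_ends P"
  shows "x \<notin> path_image (spoke p)"
proof -
  have "rays \<Delta> x 1 = x"
    using disc_raysD(3)[OF disc_rays[OF assms(1)] assms(2)] by (simp add: pathfinish_def)
  moreover have "x \<noteq> p" using assms by (auto simp: arc_ends_def)
  ultimately show ?thesis using spoke_avoids[OF assms(1,2) _ assms(4), of 1] by simp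
qed

text \<open>The outer half of the ray meets neither arcs nor spokes. This moves the comparison of
  frontier points to half the radius, where a spoke can be passed.\<close>

lemma potential_ray:
  assumes D: "\<Delta> \<in> discs P" and x: "x \<in> frontier \<Delta>" "x \<notin> arc_union P"
  shows "potential (rays \<Delta> x (1/2)) = potential x"
proof -
  define S where "S = rays \<Delta> x ` {1/2..1}"
  have r1: "rays \<Delta> x 1 = x"
    using disc_raysD(3)[OF disc_rays[OF D] x(1)] by (simp add: pathfinish_def)
  have "continuous_on {1/2..1} (rays \<Delta> x)"
    using disc_raysD(1)[OF disc_rays[OF D] x(1)] unfolding path_def
    by (rule continuous_on_subset) auto
  hence S: "connected S" unfolding S_def by (intro connected_continuous_image) auto
  have "rays \<Delta> x (1/2) \<in> S" "rays \<Delta> x 1 \<in> S" by (auto simp: S_def)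
  hence xS: "rays \<Delta> x (1/2) \<in> S" "x \<in> S" using r1 by auto
  have "rays \<Delta> x t \<notin> arc_union P" if t: "t \<in> {1/2..1}" for t
  proof (cases "t = 1")
    case True
    thus ?thesis using r1 x(2) by simp
  next
    case False
    hence "rays \<Delta> x t \<in> interior \<Delta>"
      using t by (intro disc_rays_interior[OF disc_rays[OF D] x(1)]) auto
    thus ?thesis by (rule interior_not_arc[OF D])
  qed
  hence arcs: "S \<inter> arc_union P = {}" unfolding S_def by blast
  have spokes: "S \<inter> path_image (spoke p) = {}" if p: "p \<in> arc_ends P" for p
  proof -
    have "x \<noteq> p" using x(2) p by (auto simp: arc_ends_def)
    hence "rays \<Delta> x t \<notin> path_image (spoke p)" if "t \<in> {1/2..1}" for t
      using that by (intro spoke_avoids[OF D x(1) _ p]) auto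
    thus ?thesis unfolding S_def by blast
  qed
  show ?thesis by (rule potential_constant[OF S xS arcs spokes])
qed

text \<open>Inside the disc, the spoke to \<open>c s\<close> is replaced by the detour through \<open>c t'\<close>; the winding
  number of the changed cycle does not jump between the two sides of the spoke.\<close>
lemma potential_jump:
  assumes D: "\<Delta> \<in> discs P" and cw: "clockwise_boundary \<Delta> c"
    and t: "0 < t1" "t1 < s" "s < t2" "t2 < t'" "t' < 1" and cs: "c s \<in> arc_union P"
    and only: "\<And>t. t1 \<le> t \<Longrightarrow> t \<le> t' \<Longrightarrow> c t \<in> arc_union P \<Longrightarrow> t = s"
  shows "potential (c t2) = potential (c t1) + of_int (om (c s))"
proof -
  have c: "simple_path c" "path_image c = frontier \<Delta>" using cw by (auto simp: clockwise_boundary_def)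
  have pc: "path c" using c(1) by (rule simple_path_imp_path)
  have cf: "c u \<in> frontier \<Delta>" if "0 \<le> u" "u \<le> 1" for u
    using c(2) that by (auto simp: path_image_def)
  have cinj: "u = v" if "c u = c v" "0 \<le> u" "u \<le> 1" "0 < v" "v < 1" for u v
    using c(1) that unfolding simple_path_def loop_free_def by (metis atLeastAtMost_iff less_irrefl less_imp_le)
  have fr: "c t1 \<in> frontier \<Delta>" "c t2 \<in> frontier \<Delta>" "c t' \<in> frontier \<Delta>" "c s \<in> frontier \<Delta>"
    using cf t by auto
  define e where "e = c s"
  have e: "e \<in> arc_ends P" using cs fr D by (auto simp: e_def arc_ends_def)
  have de: "disc_at e = \<Delta>" using disc_at[OF D, of e] fr frontier_disc[OF D] by (auto simp: e_def)
  have se: "spoke e = rays \<Delta> (c s)" by (simp add: spoke_def de flip: e_def)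
  note ray = disc_rays[OF D]
  define W where "W z p = (if p = e then winding_number (rays \<Delta> (c t')) z - winding_number (subpath s t' c) z
      else winding_number (spoke p) z)" for z p
  define V where "V z = winding_number (rays \<Delta> (c s)) z + winding_number (subpath s t' c) z
      - winding_number (rays \<Delta> (c t')) z" for z
  \<comment> \<open>The two cycles differ by the boundary of the sector between the rays to
    \<open>c s\<close> and \<open>c t'\<close>, with weight \<open>om e\<close>.\<close>
  have split: "cycle_winding (\<lambda>p. winding_number (spoke p) z) z = cycle_winding (W z) z + of_int (om e) * V z" for z
  proof -
    have "(\<Sum>p\<in>arc_ends P. of_int (om p) * winding_number (spoke p) z) =
        (\<Sum>p\<in>arc_ends P. of_int (om p) * W z p + (if p = e then of_int (om e) * V z else 0))"
      by (intro sum.cong refl) (auto simp: W_def V_def se algebra_simps)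
    also have "\<dots> = (\<Sum>p\<in>arc_ends P. of_int (om p) * W z p) + of_int (om e) * V z"
      using e finite_ends by (simp add: sum.distrib)
    finally show ?thesis by (simp add: cycle_winding_def)
  qed
  \<comment> \<open>A piece of the image of the circle of half the radius, which passes the spoke to
    \<open>e\<close>; since \<open>t2 < t'\<close>, it stops short of the ray used for the
    detour.\<close>
  define S where "S = (\<lambda>t. rays \<Delta> (c t) (1/2)) ` {t1..t2}"
  have SI: "S \<subseteq> interior \<Delta>"
    using disc_rays_interior[OF ray, of _ "1/2"] cf t by (auto simp: S_def)
  have connS: "connected S"
  proof -
    have "continuous_on {t1..t2} ((\<lambda>(x, t). rays \<Delta> x t) \<circ> (\<lambda>t. (c t, 1/2)))"
    proof (rule continuous_on_compose)
      show "continuous_on {t1..t2} (\<lambda>t. (c t, 1/2))"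
        using pc t unfolding path_def by (intro continuous_intros) (auto intro: continuous_on_subset)
      show "continuous_on ((\<lambda>t. (c t, 1/2)) ` {t1..t2}) (\<lambda>(x, t). rays \<Delta> x t)"
        by (rule continuous_on_subset[of "frontier \<Delta> \<times> {0..1}"])
          (use ray cf t in \<open>auto simp: disc_rays_def\<close>)
    qed
    thus ?thesis unfolding S_def by (intro connected_continuous_image) (simp_all add: o_def)
  qed
  have Sarc: "S \<inter> arc_union P = {}" using interior_not_arc[OF D] SI by blast
  have Sspoke: "S \<inter> path_image (spoke p) = {}" if p: "p \<in> arc_ends P" "p \<noteq> e" for p
  proof -
    have "rays \<Delta> (c u) (1/2) \<notin> path_image (spoke p)" if u: "u \<in> {t1..t2}" for u
    proof -
      have "c u \<noteq> p" using only[of u] p u t by (auto simp: arc_ends_def e_def)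
      thus ?thesis using spoke_avoids[OF D cf _ p(1), of u "1/2"] u t by auto
    qed
    thus ?thesis by (auto simp: S_def)
  qed
  have St': "S \<inter> path_image (rays \<Delta> (c t')) = {}"
  proof -
    have "rays \<Delta> (c u) (1/2) \<notin> path_image (rays \<Delta> (c t'))" if u: "u \<in> {t1..t2}" for u
    proof (rule disc_rays_notin[OF ray _ fr(3)])
      show "c u \<in> frontier \<Delta>" using cf[of u] u t by simp
      show "c u \<noteq> c t'" using cinj[of u t'] u t by auto
    qed auto
    thus ?thesis unfolding S_def by blast
  qed
  have subp: "path_image (subpath s t' c) \<subseteq> frontier \<Delta>"
    using path_image_subpath_subset[of s t' c] c(2) t by auto
  have Ssub: "S \<inter> path_image (subpath s t' c) = {}"
    using SI subp by (auto simp: frontier_def)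
  have psub: "path (subpath s t' c)" using pc t by simp
  note rt' = disc_raysD[OF ray fr(3)]
  have "cycle_winding (W x) x = cycle_winding (W y) y" if xy: "x \<in> S" "y \<in> S" for x y
  proof (rule continuous_Ints_constant[OF connS _ _ xy])
    show "continuous_on S (\<lambda>z. cycle_winding (W z) z)"
    proof (rule cycle_winding_continuous)
      fix p assume p: "p \<in> arc_ends P"
      show "continuous_on S (\<lambda>z. W z p)"
      proof (cases "p = e")
        case True
        have "continuous_on S (winding_number (rays \<Delta> (c t')))"
          by (rule continuous_on_subset[OF continuous_on_winding_number[OF rt'(1)]]) (use St' in auto)
        moreover have "continuous_on S (winding_number (subpath s t' c))"
          by (rule continuous_on_subset[OF continuous_on_winding_number[OF psub]]) (use Ssub in auto)
        ultimately show ?thesis unfolding W_def using True by (simp add: continuous_on_diff)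
      next
        case False
        have "continuous_on S (winding_number (spoke p))"
          by (rule continuous_on_subset[OF continuous_on_winding_number[OF spoke(1)[OF p]]])
            (use Sspoke[OF p False] in auto)
        thus ?thesis unfolding W_def using False by simp
      qed
    qed (use Sarc in blast)
    fix z assume z: "z \<in> S"
    show "cycle_winding (W z) z \<in> \<int>"
    proof (rule cycle_winding_Ints)
      fix p assume p: "p \<in> arc_ends P"
      show "W z p - (log_mod z p - log_mod z (hub (disc_at p))) \<in> \<int>"
      proof (cases "p = e")
        case True
        \<comment> \<open>Modulo integers the detour counts like the spoke: the terms at
          \<open>c t'\<close> cancel, leaving those at \<open>c s\<close> and at the hub.\<close>
        have "winding_number (rays \<Delta> (c t')) z - (log_mod z (c t') - log_mod z (hub \<Delta>)) \<in> \<int>"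
          using winding_number_log_mod[OF rt'(1), of z] rt' St' z by auto
        moreover have "winding_number (subpath s t' c) z - (log_mod z (c t') - log_mod z (c s)) \<in> \<int>"
          using winding_number_log_mod[OF psub, of z] Ssub z by auto
        ultimately have "winding_number (rays \<Delta> (c t')) z - (log_mod z (c t') - log_mod z (hub \<Delta>))
          - (winding_number (subpath s t' c) z - (log_mod z (c t') - log_mod z (c s))) \<in> \<int>"
          by (rule Ints_diff)
        thus ?thesis by (simp add: W_def True de) (simp add: e_def algebra_simps)
      next
        case False
        thus ?thesis
          using winding_number_log_mod[of "spoke p" z] spoke[OF p] Sspoke[OF p False] z by (auto simp: W_def)
      qed
    qed (use Sarc z in blast)
  qed
  moreover have "rays \<Delta> (c t1) (1/2) \<in> S" "rays \<Delta> (c t2) (1/2) \<in> S" using t by (auto simp: S_def)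
  ultimately have "cycle_winding (W (rays \<Delta> (c t1) (1/2))) (rays \<Delta> (c t1) (1/2)) =
      cycle_winding (W (rays \<Delta> (c t2) (1/2))) (rays \<Delta> (c t2) (1/2))" by blast
  moreover have "V (rays \<Delta> (c t2) (1/2)) = -1" "V (rays \<Delta> (c t1) (1/2)) = 0"
    using sector_winding_numbers[OF disc_hom[OF D] ray cw t] by (simp_all add: V_def)
  ultimately have "potential (rays \<Delta> (c t2) (1/2)) = potential (rays \<Delta> (c t1) (1/2)) + of_int (om e)"
    unfolding potential_def split by simp
  moreover have "c t1 \<notin> arc_union P" "c t2 \<notin> arc_union P" using only[of t1] only[of t2] t by auto
  ultimately show ?thesis using potential_ray[OF D] fr by (simp add: e_def)
qed

section \<open>The potential along the boundary of a disc\<close>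

lemma loop_interval:
  assumes l: "corner_loop P \<Delta> c ts" and i: "i < length ts"
  shows "0 \<le> ts ! i" "ts ! i < next_time ts i" "next_time ts i \<le> 1"
    and "\<And>t. ts ! i < t \<Longrightarrow> t < next_time ts i \<Longrightarrow> c t \<notin> arc_union P"
proof -
  note l' = corner_loopD[OF l]
  have mono: "ts ! j < ts ! k" if "j < k" "k < length ts" for j k
    using l that by (simp add: corner_loop_def sorted_wrt_nth_less)
  show 0: "0 \<le> ts ! i" using l'(6)[OF i] by simp
  show "ts ! i < next_time ts i"
    using l'(6)[OF i] mono[of i "Suc i"] by (simp add: next_time_def)
  show 1: "next_time ts i \<le> 1"
    using l'(6)[of "Suc i"] by (cases "Suc i < length ts") (simp_all add: next_time_def)
  show "c t \<notin> arc_union P" if t: "ts ! i < t" "t < next_time ts i" for t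
  proof
    assume "c t \<in> arc_union P"
    hence "t \<in> set ts" using l'(7)[of t] t 0 1 by simp
    then obtain j where j: "j < length ts" "t = ts ! j" by (metis in_set_conv_nth)
    have "\<not> j \<le> i" using mono[of j i] i j t by (cases "j = i") auto
    hence "Suc i < length ts" "\<not> j < Suc i" using j by auto
    moreover from this have "ts ! Suc i \<le> ts ! j" using mono[of "Suc i" j] j by (cases "j = Suc i") auto
    ultimately show False using t j by (simp add: next_time_def)
  qed
qed

lemma loop_frontier:
  assumes "corner_loop P \<Delta> c ts" "0 \<le> t" "t \<le> 1"
  shows "c t \<in> frontier \<Delta>"
  using corner_loopD(3)[OF assms(1)] assms(2,3) by auto

lemma loop_covers:
  assumes l: "corner_loop P \<Delta> c ts" and z: "z \<in> frontier \<Delta> - arc_union P"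
  obtains i t where "i < length ts" "ts ! i < t" "t < next_time ts i" "z = c t"
proof -
  note l' = corner_loopD[OF l]
  have "z \<in> c ` {0..1}" using z l'(3) by simp
  then obtain t where t: "0 \<le> t" "t \<le> 1" "z = c t" by auto
  define I where "I = {j. j < length ts \<and> ts ! j \<le> t}"
  have I: "finite I" "0 \<in> I" using l'(4,5) t by (auto simp: I_def)
  define i where "i = Max I"
  have "i \<in> I" using Max_in[OF I(1)] I(2) unfolding i_def by blast
  hence i: "i < length ts" "ts ! i \<le> t" by (auto simp: I_def)
  have "ts ! i \<noteq> t" using l'(6)[OF i(1)] z t by auto
  moreover have "t < next_time ts i"
  proof (cases "Suc i < length ts")
    case True
    have "Suc i \<notin> I" using Max_ge[OF I(1), of "Suc i"] unfolding i_def by auto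
    thus ?thesis using True by (simp add: I_def next_time_def)
  next
    case False
    have "t \<noteq> 1" using l'(2) l'(6)[of 0] l'(4,5) z t by auto
    thus ?thesis using False t by (simp add: next_time_def)
  qed
  ultimately have "ts ! i < t" "t < next_time ts i" using i(2) by auto
  thus thesis by (rule that[OF i(1) _ _ t(3)])
qed

text \<open>The midpoint is merely a sample; by \<open>potential_loop\<close> the whole interval has
  this value.\<close>

definition loop_value :: "(real \<Rightarrow> complex) \<Rightarrow> real list \<Rightarrow> nat \<Rightarrow> complex" where
  "loop_value c ts i = potential (c ((ts ! i + next_time ts i) / 2))"

lemma loop_continuous: "corner_loop P \<Delta> c ts \<Longrightarrow> continuous_on {0..1} c"
  using corner_loopD(1) simple_path_imp_path path_def by blast

lemma potential_loop:
  assumes D: "\<Delta> \<in> discs P" and l: "corner_loop P \<Delta> c ts" and i: "i < length ts"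
    and t: "ts ! i < t" "t < next_time ts i"
  shows "potential (c t) = loop_value c ts i"
proof -
  note I = loop_interval[OF l i]
  let ?S = "c ` {ts ! i <..< next_time ts i}"
  have off: "c u \<notin> arc_union P" "c u \<in> frontier \<Delta>" if "u \<in> {ts ! i <..< next_time ts i}" for u
    using I(4)[of u] loop_frontier[OF l, of u] that I by auto
  show ?thesis unfolding loop_value_def
  proof (rule potential_constant[of ?S])
    show "connected ?S"
      using I loop_continuous[OF l] by (intro connected_continuous_image) (auto intro: continuous_on_subset)
    show "c t \<in> ?S" "c ((ts ! i + next_time ts i) / 2) \<in> ?S" using t I(2) by auto
    show "?S \<inter> arc_union P = {}" using off(1) by blast
    show "?S \<inter> path_image (spoke p) = {}" if "p \<in> arc_ends P" for p
      using frontier_point_off_spokes[OF D off(2) off(1) that] by blast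
  qed
qed

lemma loop_value_Suc:
  assumes D: "\<Delta> \<in> discs P" and l: "corner_loop P \<Delta> c ts" and i: "Suc i < length ts"
  shows "loop_value c ts (Suc i) = loop_value c ts i + of_int (om (c (ts ! Suc i)))"
proof -
  have i': "i < length ts" using i by simp
  note I = loop_interval[OF l i'] and J = loop_interval[OF l i]
  have n: "next_time ts i = ts ! Suc i" using i by (simp add: next_time_def)
  define t1 t2 t' where "t1 = (ts ! i + next_time ts i) / 2"
    and "t2 = (ts ! Suc i + next_time ts (Suc i)) / 2" and "t' = (t2 + next_time ts (Suc i)) / 2"
  have t: "ts ! i < t1" "t1 < ts ! Suc i" "ts ! Suc i < t2" "t2 < t'" "t' < next_time ts (Suc i)"
    using I(2) J(2) n by (auto simp: t1_def t2_def t'_def)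
  have "potential (c t2) = potential (c t1) + of_int (om (c (ts ! Suc i)))"
  proof (rule potential_jump[OF D _ _ t(2-4)])
    show "clockwise_boundary \<Delta> c" using l by (simp add: corner_loop_def)
    show "0 < t1" "t' < 1" using t I(1) J(3) by auto
    show "c (ts ! Suc i) \<in> arc_union P" using corner_loopD(6)[OF l i] by simp
    fix u assume u: "t1 \<le> u" "u \<le> t'" "c u \<in> arc_union P"
    show "u = ts ! Suc i"
    proof (rule ccontr)
      assume "u \<noteq> ts ! Suc i"
      hence "u < ts ! Suc i \<or> ts ! Suc i < u" by auto
      thus False using I(4)[of u] J(4)[of u] u t n by auto
    qed
  qed
  thus ?thesis by (simp add: loop_value_def t1_def t2_def)
qed

text \<open>The last interval is the corner with which the word ends, hence the base value.
  \<open>potential_jump\<close> handles arcs met at positive times only; the jump at time 0, from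
  the last interval to the first, is inferred from the vanishing total weight.\<close>

lemma loop_value_eq:
  assumes D: "\<Delta> \<in> discs P" and l: "corner_loop P \<Delta> c ts"
    and rel: "relator_word (loop_relator P c ts) \<in> relator_cycles H R" and i: "i < length ts"
  shows "loop_value c ts i = loop_value c ts (length ts - 1) +
     of_int (sum_list (take (Suc i) (weights \<theta> (loop_relator P c ts))))"
proof -
  define w where "w = weights \<theta> (loop_relator P c ts)"
  have ne: "ts \<noteq> []" using corner_loopD(4)[OF l] .
  have w: "w = map (\<lambda>t. om (c t)) ts" using weights_loop_relator[OF ne] by (simp add: w_def)
  \<comment> \<open>Interval 0 already lies behind the first arc, whence the correction by
    \<open>w ! 0\<close>.\<close>
  have from0: "loop_value c ts j = loop_value c ts 0 + of_int (sum_list (take (Suc j) w) - w ! 0)"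
    if "j < length ts" for j
    using that
  proof (induction j)
    case 0
    thus ?case using ne by (simp add: w take_Suc hd_conv_nth)
  next
    case (Suc j)
    have "take (Suc (Suc j)) w = take (Suc j) w @ [w ! Suc j]"
      using Suc.prems by (intro take_Suc_conv_app_nth) (simp add: w)
    thus ?case using Suc loop_value_Suc[OF D l Suc.prems] by (simp add: w)
  qed
  have "sum_list w = 0" unfolding w_def by (rule total_weight_zero[OF rel nonempty adm])
  moreover have "take (Suc (length ts - 1)) w = w" using ne by (simp add: w)
  ultimately have "loop_value c ts (length ts - 1) = loop_value c ts 0 - of_int (w ! 0)"
    using from0[of "length ts - 1"] ne by simp
  thus ?thesis using from0[OF i] by (simp add: w_def)
qed

lemma next_time_last: "ts \<noteq> [] \<Longrightarrow> next_time ts (length ts - 1) = 1"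
  by (simp add: next_time_def)

lemma last_corner_potential:
  assumes D: "\<Delta> \<in> discs P" and l: "corner_loop P \<Delta> c ts"
    and z: "z \<in> c ` {last ts..1}" "z \<notin> arc_union P"
  shows "potential z = loop_value c ts (length ts - 1)"
proof -
  note l' = corner_loopD[OF l]
  obtain t where t: "last ts \<le> t" "t \<le> 1" "z = c t" using z by auto
  have la: "last ts = ts ! (length ts - 1)" using l'(4) by (rule last_conv_nth)
  have "t \<noteq> last ts" using l'(6)[of "length ts - 1"] l'(4) t z la by auto
  moreover have "t \<noteq> 1" using l'(2) l'(6)[of 0] l'(4,5) z t by auto
  ultimately show ?thesis
    using potential_loop[OF D l, of "length ts - 1" t] t la l'(4) next_time_last[of ts] by simp
qed

lemma corner_arc_points:
  assumes l: "corner_loop P \<Delta> c ts" and p: "p \<in> c ` {last ts..1}" "p \<in> arc_union P"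
  shows "p = c 0 \<or> p = c (last ts)"
proof -
  note l' = corner_loopD[OF l]
  obtain t where t: "last ts \<le> t" "t \<le> 1" "p = c t" using p by auto
  have la: "last ts = ts ! (length ts - 1)" using l'(4) by (rule last_conv_nth)
  have "\<not> (last ts < t \<and> t < 1)"
  proof
    assume "last ts < t \<and> t < 1"
    hence "c t \<notin> arc_union P"
      using loop_interval(4)[OF l, of "length ts - 1" t] la l'(4) next_time_last[of ts] by simp
    thus False using t(3) p(2) by simp
  qed
  thus ?thesis using t l'(2) by force
qed

section \<open>Regions and minimal corners\<close>

text \<open>The potential is integral on frontier points off the arcs but has complex type, hence
  \<open>Re\<close>.\<close>

definition min_point :: "complex \<Rightarrow> bool" where
  "min_point z \<longleftrightarrow> (\<forall>\<Delta> \<in> discs P. \<forall>z' \<in> frontier \<Delta> - arc_union P. Re (potential z) \<le> Re (potential z'))"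

text \<open>By \<open>loop_value_eq\<close>, a nonempty prefix sum is the potential of some interval
  of the boundary minus that of the corner, which is minimal.\<close>

lemma min_corner_nonneg:
  assumes D: "\<Delta> \<in> discs P" and l: "corner_loop P \<Delta> c ts"
    and rel: "relator_word (loop_relator P c ts) \<in> relator_cycles H R"
    and z: "z \<in> c ` {last ts..1}" "z \<notin> arc_union P" "min_point z"
    and m: "m \<le> length (loop_relator P c ts)"
  shows "0 \<le> sum_list (take m (weights \<theta> (loop_relator P c ts)))"
proof (cases m)
  case (Suc i)
  have i: "i < length ts" using m Suc length_loop_relator[OF corner_loopD(4)[OF l], of P c] by simp
  note I = loop_interval[OF l i]
  let ?t = "(ts ! i + next_time ts i) / 2"
  have "c ?t \<in> frontier \<Delta> - arc_union P"
    using I(4)[of ?t] loop_frontier[OF l, of ?t] I by auto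
  hence "Re (potential z) \<le> Re (loop_value c ts i)"
    using z(3) D unfolding min_point_def loop_value_def by blast
  thus ?thesis
    using loop_value_eq[OF D l rel i] last_corner_potential[OF D l z(1,2)] Suc by simp
qed simp

text \<open>On the frontier of a disc the potential takes at most one value for each of the finitely
  many intervals of a corner loop.\<close>

lemma exists_min_point:
  obtains \<Delta> z where "\<Delta> \<in> discs P" "z \<in> frontier \<Delta> - arc_union P" "min_point z"
proof -
  define Z where "Z = (\<Union>\<Delta>\<in>discs P. frontier \<Delta> - arc_union P)"
  have "finite (potential ` (frontier \<Delta> - arc_union P))" if D: "\<Delta> \<in> discs P" for \<Delta>
  proof -
    obtain z where "z \<in> frontier \<Delta> - arc_union P" using frontier_not_arc_nonempty[OF D] .
    then obtain c ts where l: "corner_loop P \<Delta> c ts" using exists_corner_loop[OF D] by metis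
    have "potential ` (frontier \<Delta> - arc_union P) \<subseteq> loop_value c ts ` {..<length ts}"
    proof
      fix v assume "v \<in> potential ` (frontier \<Delta> - arc_union P)"
      then obtain y where y: "y \<in> frontier \<Delta> - arc_union P" "v = potential y" by blast
      obtain i t where "i < length ts" "ts ! i < t" "t < next_time ts i" "y = c t"
        using loop_covers[OF l y(1)] .
      thus "v \<in> loop_value c ts ` {..<length ts}" using potential_loop[OF D l] y(2) by blast
    qed
    thus ?thesis using finite_subset by blast
  qed
  hence "finite (potential ` Z)" unfolding Z_def image_UN using finite_discs by blast
  hence fin: "finite ((\<lambda>z. Re (potential z)) ` Z)" by (metis finite_imageI image_image)
  obtain \<Delta>0 where "\<Delta>0 \<in> discs P" using sph by (auto simp: spherical_def)
  moreover from this obtain z0 where "z0 \<in> frontier \<Delta>0 - arc_union P" using frontier_not_arc_nonempty by blast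
  ultimately have "Z \<noteq> {}" unfolding Z_def by blast
  hence "Min ((\<lambda>z. Re (potential z)) ` Z) \<in> (\<lambda>z. Re (potential z)) ` Z" using fin by (intro Min_in) auto
  then obtain z where z: "z \<in> Z" "Re (potential z) = Min ((\<lambda>z. Re (potential z)) ` Z)" by auto
  have "Re (potential z) \<le> Re (potential z')" if "z' \<in> Z" for z'
    unfolding z(2) using fin that by (intro Min_le) auto
  hence "min_point z" unfolding min_point_def Z_def by blast
  thus thesis using z(1) that unfolding Z_def by blast
qed

section \<open>Components of the complement of the picture\<close>

abbreviation whole :: "complex set" where "whole \<equiv> disc_union P \<union> arc_union P"

lemma whole_ball: "whole \<subseteq> ball 0 1"
proof -
  have "A \<subseteq> ball 0 1" if A: "A \<in> arcs P" for A
  proof -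
    have "closed_curve_param P (along P A) \<or> proper_arc_param P (along P A)"
      using over A by (auto simp: picture_over_def)
    hence "A \<subseteq> cball 0 1"
    proof
      assume "proper_arc_param P (along P A)"
      hence "A \<subseteq> closure (cball 0 1 - disc_union P)"
        using path_image_along[OF A] by (simp add: proper_arc_param_def)
      also have "\<dots> \<subseteq> cball 0 1" by (intro closure_minimal) auto
      finally show ?thesis .
    qed (use path_image_along[OF A] in \<open>auto simp: closed_curve_param_def\<close>)
    moreover have "A \<inter> sphere 0 1 = {}" using sph A by (simp add: spherical_def)
    ultimately show ?thesis by force
  qed
  thus ?thesis using disc_ball by blast
qed

lemma closed_subunion: "\<D> \<subseteq> discs P \<Longrightarrow> \<A> \<subseteq> arcs P \<Longrightarrow> closed (\<Union>\<D> \<union> \<Union>\<A>)"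
  by (intro closed_Un closed_Union ballI)
    (use finite_discs finite_arcs disc_closed arc_compact compact_imp_closed finite_subset in blast)+

lemma whole_without_disc: "\<Delta> \<in> discs P \<Longrightarrow> whole = \<Delta> \<union> (\<Union>(discs P - {\<Delta>}) \<union> arc_union P)"
  by blast

lemma whole_without_disc_arc:
  "\<Delta> \<in> discs P \<Longrightarrow> A \<in> arcs P \<Longrightarrow> whole = \<Delta> \<union> (\<Union>(discs P - {\<Delta>}) \<union> \<Union>(arcs P - {A})) \<union> A"
  by blast

lemma corner_in_closure:
  assumes D: "\<Delta> \<in> discs P" and G: "G \<in> components (- whole)"
    and z: "z \<in> frontier \<Delta> - arc_union P" "z \<in> closure G"
  shows "closure (connected_component_set (frontier \<Delta> - arc_union P) z) \<subseteq> closure G"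
proof (rule closure_minimal)
  let ?C = "connected_component_set (frontier \<Delta> - arc_union P) z"
  have C: "?C \<subseteq> frontier \<Delta> - arc_union P" by (rule connected_component_subset)
  have "?C \<inter> (\<Union>(discs P - {\<Delta>}) \<union> arc_union P) = {}"
  proof -
    have "x \<notin> \<Union>(discs P - {\<Delta>})" if "x \<in> \<Delta>" for x using disc_eq[OF D] that by blast
    thus ?thesis using C frontier_disc[OF D] by blast
  qed
  moreover have "?C \<subseteq> frontier \<Delta>" using C by blast
  moreover have "z \<in> ?C" using z by simp
  ultimately show "?C \<subseteq> closure G"
    using frontier_connected_in_closure[OF disc_hom[OF D], of "\<Union>(discs P - {\<Delta>}) \<union> arc_union P" G ?C z]
      closed_subunion[of "discs P - {\<Delta>}" "arcs P"] G z(2) whole_without_disc[OF D] by simp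
qed simp

text \<open>\<open>G\<close> stays connected when points of its closure are added, and the spokes
  lie inside the discs, reaching the frontiers only at ends of arcs.\<close>

lemma potential_same_region:
  assumes G: "G \<in> components (- whole)"
    and x: "\<Delta> \<in> discs P" "x \<in> frontier \<Delta> - arc_union P" "x \<in> closure G"
    and y: "\<Delta>' \<in> discs P" "y \<in> frontier \<Delta>' - arc_union P" "y \<in> closure G"
  shows "potential x = potential y"
proof -
  have GM: "G \<subseteq> - whole" using G by (rule in_components_subset)
  show ?thesis
  proof (rule potential_constant[of "G \<union> {x, y}"])
    show "connected (G \<union> {x, y})"
      by (rule connected_intermediate_closure[OF in_components_connected[OF G]])
        (use x y closure_subset in auto)
    show "(G \<union> {x, y}) \<inter> arc_union P = {}" using GM x y by blast
    fix p assume p: "p \<in> arc_ends P"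
    have "insert p (interior (disc_at p)) \<subseteq> disc_at p"
      using spoke(6)[OF p] interior_subset[of "disc_at p"] frontier_disc[OF spoke(5)[OF p]] by blast
    hence "path_image (spoke p) \<subseteq> disc_at p" using spoke(4)[OF p] by (rule order_trans[rotated])
    hence "G \<inter> path_image (spoke p) = {}" using GM spoke(5)[OF p] by blast
    moreover have "x \<notin> path_image (spoke p)" "y \<notin> path_image (spoke p)"
      using frontier_point_off_spokes[OF x(1) _ _ p] frontier_point_off_spokes[OF y(1) _ _ p] x y by blast+
    ultimately show "(G \<union> {x, y}) \<inter> path_image (spoke p) = {}" by blast
  qed auto
qed

text \<open>The separation arguments take place in the plane, whereas regions are components in the
  closed unit disc. The closures are compared inside the open disc, where the corners lie.\<close>

lemma component_in_region:
  assumes G: "G \<in> components (- whole)"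
  obtains F where "F \<in> regions P" "ball 0 1 \<inter> closure G \<subseteq> closure F"
proof (cases "G \<inter> cball 0 1 = {}")
  case True
  hence "ball 0 1 \<inter> G = {}" by auto
  hence "ball 0 1 \<inter> closure G = {}" by (simp add: open_Int_closure_eq_empty)
  \<comment> \<open>The closure of \<open>G\<close> does not meet the open disc, so any region
    serves; that of the point 1 is at hand.\<close>
  moreover have "1 \<in> cball (0::complex) 1 - whole" using whole_ball by auto
  hence "connected_component_set (cball 0 1 - whole) 1 \<in> regions P"
    unfolding regions_def by (rule componentsI)
  ultimately show thesis using that by blast
next
  case False
  then obtain a where a: "a \<in> G" "a \<in> cball 0 1" by blast
  define F where "F = connected_component_set (cball 0 1 - whole) a"
  have GM: "G \<subseteq> - whole" using G by (rule in_components_subset)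
  have "a \<in> cball 0 1 - whole" using a GM by blast
  hence F: "F \<in> regions P" unfolding regions_def F_def by (rule componentsI)
  have GF: "G \<inter> cball 0 1 \<subseteq> F"
  proof
    fix b assume b: "b \<in> G \<inter> cball 0 1"
    have "connected_component (- whole) a b"
      unfolding connected_component_def using in_components_connected[OF G] GM a b by blast
    thus "b \<in> F" unfolding F_def using connected_component_cball[OF whole_ball] a b by simp
  qed
  have "ball 0 1 \<inter> closure G \<subseteq> closure (ball 0 1 \<inter> G)" by (rule open_Int_closure_subset) simp
  also have "\<dots> \<subseteq> closure F" by (rule closure_mono) (use GF ball_subset_cball in blast)
  finally show thesis using that[OF F] by blast
qed

text \<open>Only finitely many corners of the disc miss the end of the arc, so a frontier point close
  enough to that end lies on a corner that contains it.\<close>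
lemma corner_at_arc_end:
  assumes G: "G \<in> components (- whole)" and A: "A \<in> arcs P" "arc \<gamma>" "path_image \<gamma> = A"
    "A \<inter> disc_union P = {\<gamma> 0, \<gamma> 1}" and p: "\<gamma> 1 \<in> arc_ends P" "\<gamma> 1 \<in> closure G"
  obtains \<Delta> z where "\<Delta> \<in> discs P" "z \<in> frontier \<Delta> - arc_union P" "z \<in> closure G"
    "\<gamma> 1 \<in> closure (connected_component_set (frontier \<Delta> - arc_union P) z)"
proof -
  obtain \<Delta> where D: "\<Delta> \<in> discs P" "\<gamma> 1 \<in> frontier \<Delta>" using p(1) by (auto simp: arc_ends_def)
  obtain y where "y \<in> frontier \<Delta> - arc_union P" using frontier_not_arc_nonempty[OF D(1)] .
  then obtain c ts where l: "corner_loop P \<Delta> c ts" using exists_corner_loop[OF D(1)] by metis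
  define I where "I i = c ` {ts ! i..next_time ts i}" for i
  have cI: "closed (I i)" if "i < length ts" for i
    unfolding I_def using loop_interval[OF l that] loop_continuous[OF l]
    by (intro compact_imp_closed compact_continuous_image) (auto intro: continuous_on_subset)
  \<comment> \<open>The other ends are included so that the frontier point found nearby lies on no
    arc.\<close>
  define bad where "bad = (\<Union>i\<in>{i. i < length ts \<and> \<gamma> 1 \<notin> I i}. I i) \<union> (arc_ends P - {\<gamma> 1})"
  have "closed bad" unfolding bad_def
    by (intro closed_Un closed_UN) (auto intro: cI finite_imp_closed finite_ends)
  moreover have "\<gamma> 1 \<notin> bad" by (auto simp: bad_def)
  ultimately obtain \<epsilon> where \<epsilon>: "\<epsilon> > 0" "ball (\<gamma> 1) \<epsilon> \<subseteq> - bad"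
    using open_contains_ball[of "- bad"] by auto
  let ?rest = "\<Union>(discs P - {\<Delta>}) \<union> \<Union>(arcs P - {A})"
  have "\<gamma> 1 \<in> A" using A(3) by (auto simp: path_image_def)
  have n1: "\<gamma> 1 \<notin> ?rest"
    using disc_eq[OF D(1), of _ "\<gamma> 1"] arc_eq[OF A(1), of _ "\<gamma> 1"] D frontier_disc[OF D(1)] \<open>\<gamma> 1 \<in> A\<close> by blast
  have meet: "path_image \<gamma> \<inter> (\<Delta> \<union> ?rest) \<subseteq> {\<gamma> 0, \<gamma> 1}"
    using A(3,4) arc_eq[OF A(1)] D(1) by blast
  obtain z where z: "z \<in> frontier \<Delta>" "z \<in> ball (\<gamma> 1) \<epsilon>" "z \<noteq> \<gamma> 1" "z \<in> closure G"
    using closure_meets_disc_at_arc_end[OF disc_hom[OF D(1)] closed_subunion n1 A(2) meet _ D(2) p(2) \<epsilon>(1)]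
      G whole_without_disc_arc[OF D(1) A(1)] A(3) by auto
  have zb: "z \<notin> bad" using z(2) \<epsilon>(2) by blast
  have "z \<notin> arc_union P"
  proof
    assume "z \<in> arc_union P"
    hence "z \<in> arc_ends P" using z(1) D(1) by (auto simp: arc_ends_def)
    thus False using zb z(3) by (simp add: bad_def)
  qed
  hence zf: "z \<in> frontier \<Delta> - arc_union P" using z(1) by blast
  obtain i t where i: "i < length ts" "ts ! i < t" "t < next_time ts i" "z = c t"
    using loop_covers[OF l zf] .
  have "z \<in> I i" using i by (auto simp: I_def)
  hence pI: "\<gamma> 1 \<in> I i" using zb i(1) by (auto simp: bad_def)
  note J = loop_interval[OF l i(1)]
  have cont: "continuous_on {ts ! i..next_time ts i} c"
    using J loop_continuous[OF l] by (auto intro: continuous_on_subset)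
  let ?S = "c ` {ts ! i<..<next_time ts i}"
  have "I i = c ` closure {ts ! i<..<next_time ts i}" using J(2) by (simp add: I_def)
  also have "\<dots> \<subseteq> closure ?S"
    using cont J(2) by (intro image_closure_subset[OF _ _ closure_subset]) auto
  also have "?S \<subseteq> connected_component_set (frontier \<Delta> - arc_union P) z"
  proof (rule connected_component_maximal)
    show "z \<in> ?S" using i by auto
    show "connected ?S" using cont by (intro connected_continuous_image) (auto intro: continuous_on_subset)
    show "?S \<subseteq> frontier \<Delta> - arc_union P" using J(4) loop_frontier[OF l] J(1,3) by auto
  qed
  hence "closure ?S \<subseteq> closure (connected_component_set (frontier \<Delta> - arc_union P) z)" by (rule closure_mono)
  finally show thesis using that[OF D(1) zf z(4)] pI by blast
qed

lemma corner_span_last: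
  assumes D: "\<Delta> \<in> discs P" and l: "corner_loop P \<Delta> c ts"
  shows "corner_span P (c ` {last ts..1}) (c (last ts)) (c 0)"
proof -
  note l' = corner_loopD[OF l]
  have la: "last ts = ts ! (length ts - 1)" using l'(4) by (rule last_conv_nth)
  have i: "length ts - 1 < length ts" using l'(4) by simp
  note I = loop_interval[OF l i, unfolded next_time_last[OF l'(4)], folded la]
  have "c ` {last ts<..<1} \<inter> arc_union P = {}" using I(4) by auto
  moreover have "c 0 \<in> arc_union P" using l'(6)[of 0] l'(4,5) by simp
  moreover have "c (last ts) \<in> arc_union P" using l'(6)[OF i] la by simp
  moreover have "clockwise_boundary \<Delta> c" using l by (simp add: corner_loop_def)
  ultimately show ?thesis
    unfolding corner_span_def using D I(1,2) l'(2)
    by (intro bexI[of _ \<Delta>] exI[of _ c] exI[of _ "last ts"] exI[of _ 1]) auto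
qed

section \<open>The dipole at a minimal corner\<close>

lemma has_dipole_of_unique_min:
  assumes strict: "strict_weight X \<theta>" and lr: "l \<in> {1..length R}"
    and min: "\<And>j. j \<in> {1..length R} - {l} \<Longrightarrow>
        prefix_weight \<theta> (skeleton R) j > prefix_weight \<theta> (skeleton R) l"
    and distinct: "fst (skeleton R ! (l - 1)) \<noteq> fst (skeleton R ! (l mod length R))"
  shows "has_dipole H P"
proof -
  \<comment> \<open>The relator read from just behind the minimum: it begins with
    \<open>x_(l+1)\<close> and ends with \<open>x_l h_l\<close>, so that a minimal corner carries
    \<open>h_l\<close> or its inverse.\<close>
  define Q where "Q = rotate l R"
  have Q: "Q \<noteq> []" "length Q = length R" using nonempty by (auto simp: Q_def)
  have "Q ! 0 = R ! (l mod length R)" using nth_rotate[of 0 R l] nonempty by (simp add: Q_def)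
  moreover have "Q ! (length R - 1) = R ! (l - 1)"
  proof -
    have "(l + (length R - 1)) mod length R = (l - 1 + length R) mod length R" using lr by simp
    also have "\<dots> = (l - 1) mod length R" by (rule mod_add_self2)
    also have "\<dots> = l - 1" using lr by (intro mod_less) auto
    finally show ?thesis using nth_rotate[of "length R - 1" R l] nonempty by (simp add: Q_def)
  qed
  ultimately have Qne: "fst (hd Q) \<noteq> fst (last Q)"
    using distinct Q lr nonempty by (auto simp: hd_conv_nth last_conv_nth skeleton_def case_prod_beta)
  note cases = minimal_cycle_cases[OF _ adm lr min, folded Q_def]
  obtain \<Delta> z where D: "\<Delta> \<in> discs P" and z: "z \<in> frontier \<Delta> - arc_union P" "min_point z"
    using exists_min_point .
  define C where "C = connected_component_set (frontier \<Delta> - arc_union P) z"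
  obtain c ts where l: "corner_loop P \<Delta> c ts" and k: "closure C = c ` {last ts..1}"
    and rel: "relator_word (loop_relator P c ts) \<in> relator_cycles H R" and kc: "closure C \<in> corners P"
    using exists_corner_loop[OF D z(1)] unfolding C_def by metis
  define L where "L = loop_relator P c ts"
  have zk: "z \<in> c ` {last ts..1}" using z(1) closure_subset unfolding k[symmetric] C_def by fastforce
  have nn: "0 \<le> sum_list (take m (weights \<theta> L))" if "m \<le> length L" for m
    using min_corner_nonneg[OF D l rel zk _ z(2)] z(1) that unfolding L_def by blast
  have LQ: "L = Q \<or> L = inv_relator H Q"
    using cases[of L] rel nn unfolding L_def by blast
  note l' = corner_loopD[OF l]
  obtain G where G: "G \<in> components (- whole)" "z \<in> closure G"
  proof -
    let ?rest = "\<Union>(discs P - {\<Delta>}) \<union> arc_union P"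
    have "z \<in> \<Delta>" using z(1) frontier_disc[OF D] by blast
    hence "z \<notin> ?rest" using z(1) disc_eq[OF D] by blast
    thus thesis
      using frontier_point_in_closure[OF disc_hom[OF D] closed_subunion, of "discs P - {\<Delta>}" "arcs P" z]
        z(1) that whole_without_disc[OF D] by auto
  qed
  have kG: "closure C \<subseteq> closure G" unfolding C_def by (rule corner_in_closure[OF D G(1) z(1) G(2)])
  \<comment> \<open>The clockwise end of the corner, equal to \<open>c 1\<close>; the first letter
    of its word is read here.\<close>
  define q where "q = c 0"
  have q: "q \<in> arc_ends P" "q \<in> frontier \<Delta>"
    using l'(6)[of 0] l'(4,5) loop_frontier[OF l, of 0] D by (auto simp: q_def arc_ends_def)
  have "last ts \<le> 1" using l'(6)[of "length ts - 1"] l'(4) by (simp add: last_conv_nth)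
  hence "q \<in> closure C" unfolding k q_def using l'(2) by (metis atLeastAtMost_iff image_eqI order_refl)
  hence qG: "q \<in> closure G" using kG by blast
  obtain A \<gamma> where A: "A \<in> arcs P" "arc \<gamma>" "path_image \<gamma> = A" "\<gamma> 0 = q" "A \<inter> disc_union P = {q, \<gamma> 1}"
    "\<gamma> 1 \<in> arc_ends P" and cr: "crossing P (\<gamma> 1) = (fst (crossing P q), - snd (crossing P q))"
    and crq: "crossing P q \<in> X \<times> {1, -1}"
    using arc_at_end[OF q(1)] .
  define p where "p = \<gamma> 1"
  have pG: "p \<in> closure G"
  proof -
    let ?rest = "\<Union>(discs P - {\<Delta>}) \<union> \<Union>(arcs P - {A})"
    have "q \<in> A" "q \<in> \<Delta>" using A(3,4) q(2) frontier_disc[OF D] by (auto simp: path_image_def)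
    hence n0: "\<gamma> 0 \<notin> ?rest" using disc_eq[OF D] arc_eq[OF A(1)] A(4) by blast
    have meet: "path_image \<gamma> \<inter> (\<Delta> \<union> ?rest) \<subseteq> {\<gamma> 0, \<gamma> 1}"
      using A(3,4,5) arc_eq[OF A(1)] D by blast
    have "\<gamma> 1 \<in> \<Delta> \<union> ?rest" using A(5) D by blast
    hence "path_image \<gamma> \<subseteq> closure G"
      using arc_from_disc_in_closure[OF disc_hom[OF D] closed_subunion n0 A(2) meet]
        G(1) whole_without_disc_arc[OF D A(1)] A(3,4) q(2) qG by auto
    thus ?thesis unfolding p_def by (auto simp: path_image_def)
  qed
  obtain \<Delta>' z' where D': "\<Delta>' \<in> discs P" and z': "z' \<in> frontier \<Delta>' - arc_union P" "z' \<in> closure G"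
    and pk: "p \<in> closure (connected_component_set (frontier \<Delta>' - arc_union P) z')"
    using corner_at_arc_end[OF G(1) A(1,2,3) _ A(6)] A(4,5) pG unfolding p_def by metis
  define C' where "C' = connected_component_set (frontier \<Delta>' - arc_union P) z'"
  obtain c' ts' where m: "corner_loop P \<Delta>' c' ts'" and k': "closure C' = c' ` {last ts'..1}"
    and rel': "relator_word (loop_relator P c' ts') \<in> relator_cycles H R" and kc': "closure C' \<in> corners P"
    using exists_corner_loop[OF D' z'(1)] unfolding C'_def by metis
  define L' where "L' = loop_relator P c' ts'"
  note m' = corner_loopD[OF m]
  have "potential z' = potential z"
    by (rule potential_same_region[OF G(1) D' z' D z(1) G(2)])
  hence minz': "min_point z'" using z(2) by (simp add: min_point_def)
  have zk': "z' \<in> c' ` {last ts'..1}" using z'(1) closure_subset unfolding k'[symmetric] C'_def by fastforce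
  have nn': "0 \<le> sum_list (take m (weights \<theta> L'))" if "m \<le> length L'" for m
    using min_corner_nonneg[OF D' m rel' zk' _ minz'] z'(1) that unfolding L'_def by blast
  have LQ': "L' = Q \<or> L' = inv_relator H Q"
    using cases[of L'] rel' nn' unfolding L'_def by blast
  have kG': "closure C' \<subseteq> closure G" unfolding C'_def by (rule corner_in_closure[OF D' G(1) z'])
  have lens: "length L = length ts" "length L' = length ts'"
    unfolding L_def L'_def using l'(4) m'(4) by (simp_all add: length_loop_relator)
  have first: "om (c 0) \<ge> 0"
    using nn[of 1] l'(4,5) lens unfolding L_def by (cases ts) (simp_all add: weights_loop_relator)
  have first': "om (c' 0) \<ge> 0"
    using nn'[of 1] m'(4,5) lens unfolding L'_def by (cases ts') (simp_all add: weights_loop_relator)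
  \<comment> \<open>At both minimal corners the first letter has nonnegative weight. Hence the
    weight is positive at \<open>q\<close> and negative at \<open>p\<close>, so \<open>p\<close> is
    where the second corner begins, not where it ends.\<close>
  have "om p = - om q" "om q \<noteq> 0"
    using cr crq strict by (auto simp: p_def crossing_weight_def strict_weight_def)
  hence "p \<noteq> c' 0" using first first' by (auto simp: q_def)
  hence pl: "p = c' (last ts')"
    using corner_arc_points[OF m, of p] pk A(6) unfolding C'_def[symmetric] k' by (auto simp: p_def arc_ends_def)
  have hdL: "fst (hd L) = fst (crossing P q)"
    using fst_loop_relator_nth[of 0 ts P c] l'(4,5) lens unfolding L_def q_def
    by (metis hd_conv_nth length_greater_0_conv)
  have lastL': "fst (last L') = fst (crossing P q)"
    using fst_loop_relator_nth[of "length ts' - 1" ts' P c'] m'(4) lens cr pl unfolding L'_def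
    by (metis diff_less fst_conv last_conv_nth length_greater_0_conv p_def zero_less_one)
  \<comment> \<open>The arc carries the first letter of \<open>L\<close> and the last letter of
    \<open>L'\<close>. If both lists were \<open>Q\<close>, or both its inverse, then
    \<open>Q\<close> would begin and end with the same generator.\<close>
  have LL: "L = Q \<and> L' = inv_relator H Q \<or> L = inv_relator H Q \<and> L' = Q"
    using LQ LQ' hdL lastL' hd_last_inv_relator[OF Q(1), of H] Qne by metis
  obtain S h where S: "S \<noteq> []" "is_gen (hd S)" "is_gen (last S)" "relator_word Q = S @ [Coef h]"
    "relator_word (inv_relator H Q) = word_inv H S @ [Coef (inv\<^bsub>H\<^esub> h)]"
    using relator_word_split[OF Q(1)] .
  have w: "corner_word P (closure C) (relator_word L)" "corner_word P (closure C') (relator_word L')"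
    unfolding corner_word_iff L_def L'_def using D D' l m k k' by blast+
  obtain F where F: "F \<in> regions P" "ball 0 1 \<inter> closure G \<subseteq> closure F"
    using component_in_region[OF G(1)] .
  have "closure C \<subseteq> \<Delta>" unfolding C_def
    by (rule closure_minimal[OF _ disc_closed[OF D]])
      (use connected_component_subset frontier_disc[OF D] in blast)
  hence cF: "closure C \<subseteq> closure F" using F(2) kG disc_ball[OF D] by blast
  have "closure C' \<subseteq> \<Delta>'" unfolding C'_def
    by (rule closure_minimal[OF _ disc_closed[OF D']])
      (use connected_component_subset frontier_disc[OF D'] in blast)
  hence cF': "closure C' \<subseteq> closure F" using F(2) kG' disc_ball[OF D'] by blast
  have "corner_endpoint P (closure C) q"
    unfolding corner_endpoint_def q_def k using corner_span_last[OF D l] by blast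
  moreover have "corner_endpoint P (closure C') p"
    unfolding corner_endpoint_def pl k' using corner_span_last[OF D' m] by blast
  moreover have ps: "pathstart \<gamma> = q" "pathfinish \<gamma> = p"
    using A(4) by (simp_all add: p_def pathstart_def pathfinish_def)
  have "joins A q p" unfolding joins_def using A(2,3) ps by blast
  moreover have "joins A p q" unfolding joins_def
    using A(2,3) ps by (intro exI[of _ "reversepath \<gamma>"]) (simp add: arc_reversepath)
  \<comment> \<open>Both orders are provided, since either corner may be the one that reads
    \<open>Q\<close>.\<close>
  ultimately have ends: "\<exists>p q. joins A p q \<and> corner_endpoint P (closure C) p \<and> corner_endpoint P (closure C') q"
    "\<exists>p q. joins A p q \<and> corner_endpoint P (closure C') p \<and> corner_endpoint P (closure C) q" by blast+
  from LL show ?thesis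
  proof
    assume "L = Q \<and> L' = inv_relator H Q"
    hence "corner_word P (closure C) (S @ [Coef h])"
      "corner_word P (closure C') (word_inv H S @ [Coef (inv\<^bsub>H\<^esub> h)])" using w S by auto
    thus ?thesis unfolding has_dipole_def using kc kc' A(1) ends(1) F(1) cF cF' S(1-3) by blast
  next
    assume "L = inv_relator H Q \<and> L' = Q"
    hence "corner_word P (closure C') (S @ [Coef h])"
      "corner_word P (closure C) (word_inv H S @ [Coef (inv\<^bsub>H\<^esub> h)])" using w S by auto
    thus ?thesis unfolding has_dipole_def using kc kc' A(1) ends(2) F(1) cF cF' S(1-3) by blast
  qed
qed

end

theorem theorem6:
  fixes X :: "'x set" and H :: "('h, 'm) monoid_scheme" and R :: "('x, 'h) relator"
  assumes "relative_presentation X H R"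
    and "unique_min X (skeleton R)"
  shows "aspherical X H R"
  unfolding aspherical_def
proof (intro allI impI)
  fix P :: "('x, 'h) labelled_picture"
  assume P: "picture_over X H R P \<and> connected_picture P \<and> spherical P"
  obtain \<theta> l where u: "strict_weight X \<theta>" "admissible \<theta> (skeleton R)" "l \<in> {1..length (skeleton R)}"
    "\<forall>j \<in> {1..length (skeleton R)} - {l}. prefix_weight \<theta> (skeleton R) j > prefix_weight \<theta> (skeleton R) l"
    "fst (skeleton R ! (l - 1)) \<noteq> fst (skeleton R ! (l mod length (skeleton R)))"
    using assms(2) unfolding unique_min_def by blast
  have len: "length (skeleton R) = length R" by (simp add: skeleton_def)
  have "R \<noteq> []" using assms(1) by (simp add: relative_presentation_def)
  then interpret weighted_picture X H R P \<theta>
    using P u(2) by unfold_locales auto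
  show "has_dipole H P"
    by (rule has_dipole_of_unique_min[of l]) (use u in \<open>auto simp: len\<close>)
qed

end
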